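(* Let $A\in\mathbb{R}^{n\times n}$ be an invertible matrix and let $1<p<\infty$. Suppose that $\varphi$ is a Young function whose complementary function satisfies $\overline{\varphi}\in B_p$, and that $w$ is a weight in $\mathcal{A}_{A,p,\varphi}$. Then $M_{A^{-1}}$ is bounded on $L^p(w)$, i.e. there is a constant $C$ such that $\int_{\mathbb{R}^n} (M_{A^{-1}}f)^p\, w\,dx\le C\int_{\mathbb{R}^n}|f|^p\, w\,dx$ for all $f\in L^p(w)$.
   Context: A weight is a locally integrable function $w$ on $\mathbb{R}^n$ with $0<w<\infty$ a.e. Cubes $Q$ have sides parallel to the axes. For an invertible matrix $A$, $w_A(x)=w(Ax)$ and $M_{A^{-1}}f(x)=Mf(A^{-1}x)=\sup_{Q\ni A^{-1}x}\frac1{|Q|}\int_Q|f(y)|\,dy$, where $M$ is the (uncentered) Hardy-Littlewood maximal operator. A Young function is a function $\Psi:[0,\infty)\to[0,\infty)$ that is continuous, convex, non-decreasing, with $\Psi(0)=0$ and $\lim_{t\to\infty}\Psi(t)=\infty$. Its complementary function is $\overline{\Psi}(t)=\sup_{s\ge 0}(st-\Psi(s))$. The Luxemburg average on a cube is $\|f\|_{\Psi,Q}=\inf\{\lambda>0:\frac1{|Q|}\int_Q\Psi(|f|/\lambda)\le 1\}$, and for $1\le r<\infty$, $\|f\|_{r,Q}=\left(\frac1{|Q|}\int_Q|f|^r\right)^{1/r}$. A Young function $\Psi$ belongs to $B_p$ if $\int_1^\infty\frac{\Psi(t)}{t^p}\frac{dt}{t}<\infty$. A weight $w$ belongs to $\mathcal{A}_{A,p,\varphi}$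 if $[w]_{\mathcal{A}_{A,p,\varphi}}=\sup_Q\|w_A^{1/p}\|_{p,Q}\,\|w^{-1/p}\|_{\varphi,Q}<\infty$, the supremum being over all cubes $Q$. *)

theory Defs
  imports "HOL-Analysis.Analysis"
begin

(* Closed cubes; replacing them by open ones changes none of the suprema below. *)
definition cubes :: "(real ^ 'n) set set" where
  "cubes = {cbox a (a + vec l) | a l. (0::real) < l}"

definition weight :: "(real ^ 'n \<Rightarrow> real) \<Rightarrow> bool" where
  "weight w \<longleftrightarrow> (\<forall>K. compact K \<longrightarrow> set_integrable lebesgue K w) \<and> (AE x in lebesgue. 0 < w x)"

(* Real power of an extended nonnegative number, for exponents r > 0. *)
definition epowr :: "ennreal \<Rightarrow> real \<Rightarrow> ennreal" where
  "epowr x r = (if x = \<infinity> then \<infinity> else ennreal (enn2real x powr r))"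

definition average :: "(real ^ 'n) set \<Rightarrow> (real ^ 'n \<Rightarrow> ennreal) \<Rightarrow> ennreal" where
  "average Q g = (\<integral>\<^sup>+y\<in>Q. g y \<partial>lebesgue) / emeasure lebesgue Q"

definition maximal :: "(real ^ 'n \<Rightarrow> real) \<Rightarrow> real ^ 'n \<Rightarrow> ennreal" where
  "maximal f x = (SUP Q\<in>{Q \<in> cubes. x \<in> Q}. average Q (\<lambda>y. ennreal \<bar>f y\<bar>))"

definition maximal_inv :: "real ^ 'n ^ 'n \<Rightarrow> (real ^ 'n \<Rightarrow> real) \<Rightarrow> real ^ 'n \<Rightarrow> ennreal" where
  "maximal_inv A f x = maximal f (matrix_inv A *v x)"

(* Functions on [0,\<infinity>) are represented by functions on the reals whose values at
   negative arguments are irrelevant. *)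
definition young_function :: "(real \<Rightarrow> real) \<Rightarrow> bool" where
  "young_function \<Psi> \<longleftrightarrow>
     (\<forall>t\<ge>0. 0 \<le> \<Psi> t) \<and> continuous_on {0..} \<Psi> \<and> convex_on {0..} \<Psi> \<and> mono_on {0..} \<Psi> \<and>
     \<Psi> 0 = 0 \<and> filterlim \<Psi> at_top at_top"

(* The supremum may be infinite (for example if \<Psi> t = t), hence the extended values.
   Truncating negative terms to 0 is harmless, as s = 0 contributes 0. *)
definition complementary :: "(real \<Rightarrow> real) \<Rightarrow> real \<Rightarrow> ennreal" where
  "complementary \<Psi> t = (SUP s\<in>{0..}. ennreal (s * t - \<Psi> s))"

(* Stated for extended-valued functions, so that it applies to complementary functions;
   membership includes being a finite-valued Young function. *)
definition B_class :: "real \<Rightarrow> (real \<Rightarrow> ennreal) set" where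
  "B_class p = {\<Psi>. (\<forall>t\<ge>0. \<Psi> t < \<infinity>) \<and> young_function (\<lambda>t. enn2real (\<Psi> t)) \<and>
     (\<integral>\<^sup>+t\<in>{1..}. \<Psi> t / ennreal (t powr p) / ennreal t \<partial>lborel) < \<infinity>}"

definition Lp_average :: "real \<Rightarrow> (real ^ 'n) set \<Rightarrow> (real ^ 'n \<Rightarrow> real) \<Rightarrow> ennreal" where
  "Lp_average r Q f = epowr (average Q (\<lambda>y. ennreal (\<bar>f y\<bar> powr r))) (1 / r)"

definition luxemburg :: "(real \<Rightarrow> real) \<Rightarrow> (real ^ 'n) set \<Rightarrow> (real ^ 'n \<Rightarrow> real) \<Rightarrow> ennreal" where
  "luxemburg \<Psi> Q f =
     (INF c\<in>{c::real. 0 < c \<and> average Q (\<lambda>y. ennreal (\<Psi> (\<bar>f y\<bar> / c))) \<le> 1}. ennreal c)"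

(* Both factors are nonzero when w is a weight, so the convention 0 * \<infinity> = 0 plays no role. *)
definition A_const ::
  "real ^ 'n ^ 'n \<Rightarrow> real \<Rightarrow> (real \<Rightarrow> real) \<Rightarrow> (real ^ 'n \<Rightarrow> real) \<Rightarrow> ennreal" where
  "A_const A p \<phi> w =
     (SUP Q\<in>cubes. Lp_average p Q (\<lambda>x. w (A *v x) powr (1 / p))
                   * luxemburg \<phi> Q (\<lambda>x. w x powr (- 1 / p)))"

definition A_class ::
  "real ^ 'n ^ 'n \<Rightarrow> real \<Rightarrow> (real \<Rightarrow> real) \<Rightarrow> (real ^ 'n \<Rightarrow> real) set" where
  "A_class A p \<phi> = {w. weight w \<and> A_const A p \<phi> w < \<infinity>}"

definition Lp_weighted :: "real \<Rightarrow> (real ^ 'n \<Rightarrow> real) \<Rightarrow> (real ^ 'n \<Rightarrow> real) set" where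
  "Lp_weighted p w = {f \<in> borel_measurable lebesgue.
     (\<integral>\<^sup>+x. ennreal (\<bar>f x\<bar> powr p) * ennreal (w x) \<partial>lebesgue) < \<infinity>}"

end

(* Substituting y = A^{-1} x turns the claim into a two-weight inequality for M with the pair
   (w_A, w), which the bump condition controls. Let O_k be the set where M f > b^k. Choosing at
   each point of O_k a cube of nearly maximal side on which the average of |f| exceeds b^k, a
   Vitali covering yields disjoint cubes Q whose dilates P cover O_k and satisfy avg_P |f| <= b^k.
   By the weak (1,1) inequality at least half of each Q lies in O_k - O_{k+1} once b is large.
   With g = |f| w^{1/p} and psi the complementary function, generalized Hoelder and the bump
   condition give b^{kp} w_A(P) <= C ||g||_{psi,P}^p |P|, and this is at most a constant times
   the integral of (M_psi g)^p over the part of Q in O_k - O_{k+1}. These sets are disjoint in k,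
   so everything is bounded by the integral of (M_psi g)^p, hence by that of g^p since psi is in B_p. *)
theory Submission
  imports Defs
begin

subsection \<open>Cubes and the Vitali covering lemma\<close>

text \<open>The bump condition compares both norms on the same cube, and w_A is not assumed
  doubling, so an estimate on Q could not be carried over to P. The condition is therefore applied
  on P itself, at the price of knowing only avg_P |f| > b^k / D, where D = (10 n)^n = |P| / |Q|. The
  ratio is b = 2 D^2: one D is the weak (1,1) constant, one comes from |P| = D |Q|, and 2 from
  asking for half of Q. The weak bound can be localized because all longer cubes through the
  stopping point have average at most b^k, which confines to P the cubes that witness O_{k+1} inside
  Q. M_psi g at any point of P dominates ||g||_{psi,P}; hence the bound can be integrated over a
  small part of Q. Stopping cubes need bounded sides, which integrability supplies; a general f is
  reached by truncation, with g kept fixed so that the bound does not depend on the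
  truncation.\<close>

lemma less_divide_ennreal_real:
  assumes "0 < v" shows "t < x / ennreal v \<longleftrightarrow> t * ennreal v < x"
proof (cases x)
  case (real r)
  show ?thesis
  proof (cases t)
    case (real s)
    then show ?thesis
      using assms \<open>0 \<le> r\<close> \<open>x = ennreal r\<close>
      by (simp add: divide_ennreal ennreal_mult[symmetric] ennreal_less_iff pos_less_divide_eq)
  next
    case top
    then show ?thesis
      using assms by (simp add: ennreal_top_mult real)
  qed
next
  case top
  then show ?thesis
    using assms by (auto simp: ennreal_top_divide ennreal_mult_less_top less_top[symmetric] ennreal_mult_eq_top_iff)
qed

lemma divide_le_ennreal_real:
  assumes "0 < v" shows "x / ennreal v \<le> t \<longleftrightarrow> x \<le> t * ennreal v"
  using less_divide_ennreal_real[OF assms, of t x] by (simp add: not_less[symmetric])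

definition cube :: "real ^ 'n \<Rightarrow> real \<Rightarrow> (real ^ 'n) set" where
  "cube a l = cbox a (a + vec l)"

lemma mem_cube: "x \<in> cube a l \<longleftrightarrow> (\<forall>i. a $ i \<le> x $ i \<and> x $ i \<le> a $ i + l)"
  by (simp add: cube_def mem_box_cart)

lemma cubes_eq: "cubes = {cube a l | a l. 0 < l}"
  by (simp add: cubes_def cube_def)

lemma cube_in_cubes: "0 < l \<Longrightarrow> cube a l \<in> cubes"
  by (auto simp: cubes_eq)

(* As a simp rule it turns the Lebesgue measure of measurable sets into the measure of main_part. *)
declare emeasure_completion [simp del]

lemma cube_sets_lebesgue [measurable, simp]: "cube a l \<in> sets lebesgue"
  by (simp add: cube_def)

lemma emeasure_cube:
  fixes a :: "real ^ 'n"
  assumes "0 \<le> l"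
  shows "emeasure lebesgue (cube a l) = ennreal (l ^ CARD('n))"
proof -
  have "cbox a (a + vec l) \<noteq> {}"
    using assms by (simp add: interval_ne_empty_cart)
  then have "measure lborel (cbox a (a + vec l)) = l ^ CARD('n)"
    by (simp add: content_cbox_cart)
  moreover have "emeasure lborel (cbox a (a + vec l)) = ennreal (measure lborel (cbox a (a + vec l)))"
    by (intro emeasure_eq_ennreal_measure) (simp add: emeasure_lborel_cbox_eq)
  ultimately show ?thesis by (simp add: cube_def emeasure_completion)
qed

text \<open>Centred at the corner \<open>a\<close>, not at the centre of the cube: the Vitali lemma
  is applied to balls about \<open>a\<close> of radius \<open>CARD('n) * l\<close>, and five times
  such a ball lies in this set. Being itself a cube, it can enter the stopping rule and the bump
  condition.\<close>

definition dilate :: "real ^ 'n \<Rightarrow> real \<Rightarrow> (real ^ 'n) set" where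
  "dilate a l = cube (a - vec (5 * real CARD('n) * l)) (10 * real CARD('n) * l)"

lemma mem_dilate:
  fixes a :: "real ^ 'n"
  shows "x \<in> dilate a l \<longleftrightarrow> (\<forall>i. \<bar>x $ i - a $ i\<bar> \<le> 5 * real CARD('n) * l)"
  unfolding dilate_def mem_cube
  by (intro iff_allI) (auto simp: abs_le_iff algebra_simps)

lemma cube_subset_dilate:
  fixes a :: "real ^ 'n"
  assumes "0 < l" shows "cube a l \<subseteq> dilate a l"
proof
  fix x assume "x \<in> cube a l"
  moreover have "l \<le> 5 * real CARD('n) * l"
  proof -
    have "1 \<le> real CARD('n)" by (simp add: Suc_leI)
    then have "1 * l \<le> (5 * real CARD('n)) * l" using assms by (intro mult_right_mono) linarith+
    then show ?thesis by simp
  qed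
  ultimately show "x \<in> dilate a l"
    unfolding mem_cube mem_dilate by (smt (verit))
qed

lemma cube_subset_cball:
  fixes a :: "real ^ 'n"
  assumes "0 \<le> l" shows "cube a l \<subseteq> cball a (real CARD('n) * l)"
proof
  fix x assume x: "x \<in> cube a l"
  have "norm (x - a) \<le> (\<Sum>i\<in>UNIV. \<bar>(x - a) $ i\<bar>)" by (rule norm_le_l1_cart)
  also have "\<dots> \<le> (\<Sum>i\<in>(UNIV::'n set). l)"
    using x by (intro sum_mono) (auto simp: mem_cube abs_le_iff algebra_simps)
  finally show "x \<in> cball a (real CARD('n) * l)" by (simp add: dist_norm norm_minus_commute)
qed

text \<open>The covering lemma for balls is applied to balls about the corners that contain the
  cubes. Disjoint balls give disjoint cubes, and the fivefold balls fit into the dilates. The common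
  bound \<open>B\<close> on the sides is what the ball version asks for, so every use has to supply
  one.\<close>

lemma vitali_cubes:
  fixes a :: "'i \<Rightarrow> real ^ 'n"
  assumes l: "\<And>i. i \<in> I \<Longrightarrow> 0 < l i \<and> l i \<le> B"
  obtains C where "countable C" "C \<subseteq> I" "disjoint_family_on (\<lambda>i. cube (a i) (l i)) C"
    "(\<Union>i\<in>I. cube (a i) (l i)) \<subseteq> (\<Union>i\<in>C. dilate (a i) (l i))"
proof -
  define n where "n = real CARD('n)"
  have n: "0 < n" by (simp add: n_def)
  have B: "0 < n * l i \<and> n * l i \<le> n * B" if "i \<in> I" for i using l[OF that] n by simp
  have sub: "cube (a i) (l i) \<subseteq> cball (a i) (n * l i)" if "i \<in> I" for i
    unfolding n_def using l[OF that] by (intro cube_subset_cball) simp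
  have "(\<Union>i\<in>I. cube (a i) (l i)) \<subseteq> (\<Union>i\<in>I. cball (a i) (n * l i))"
    by (intro UN_mono sub) auto
  then obtain C where C: "countable C" "C \<subseteq> I"
     "pairwise (\<lambda>i j. disjnt (cball (a i) (n * l i)) (cball (a j) (n * l j))) C"
     "(\<Union>i\<in>I. cube (a i) (l i)) \<subseteq> (\<Union>i\<in>C. cball (a i) (5 * (n * l i)))"
    by (rule Vitali_covering_lemma_cballs[where K = I and a = a and r = "\<lambda>i. n * l i" and B = "n * B"]) (use B in auto)
  show thesis
  proof (rule that[of C])
    show "countable C" "C \<subseteq> I" by fact+
    show "disjoint_family_on (\<lambda>i. cube (a i) (l i)) C"
      unfolding disjoint_family_on_def
    proof (intro ballI impI)
      fix i j assume ij: "i \<in> C" "j \<in> C" "i \<noteq> j"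
      then have "cball (a i) (n * l i) \<inter> cball (a j) (n * l j) = {}"
        using pairwiseD[OF C(3)] by (simp add: disjnt_def)
      moreover have "cube (a i) (l i) \<subseteq> cball (a i) (n * l i)" "cube (a j) (l j) \<subseteq> cball (a j) (n * l j)"
        using ij C(2) sub by auto
      ultimately show "cube (a i) (l i) \<inter> cube (a j) (l j) = {}"
        by (metis Int_mono subset_empty)
    qed
    have "cball (a i) (5 * (n * l i)) \<subseteq> dilate (a i) (l i)" for i
    proof
      fix x assume "x \<in> cball (a i) (5 * (n * l i))"
      then have "norm (x - a i) \<le> 5 * n * l i" by (simp add: dist_norm norm_minus_commute)
      then show "x \<in> dilate (a i) (l i)"
        unfolding mem_dilate n_def using order_trans[OF component_le_norm_cart[of "x - a i"]]
        by (simp add: mult.assoc)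
    qed
    then show "(\<Union>i\<in>I. cube (a i) (l i)) \<subseteq> (\<Union>i\<in>C. dilate (a i) (l i))"
      by (intro order_trans[OF C(4)] UN_mono) auto
  qed
qed

lemma emeasure_dilate:
  fixes a :: "real ^ 'n"
  assumes "0 \<le> l"
  shows "emeasure lebesgue (dilate a l) = ennreal ((10 * real CARD('n)) ^ CARD('n)) * emeasure lebesgue (cube a l)"
  using assms by (simp add: dilate_def emeasure_cube power_mult_distrib ennreal_mult mult.assoc)

section \<open>Countable sums of measures and integrals\<close>

lemma emeasure_UN_le_nn_integral:
  assumes C: "countable C" and X: "\<And>i. i \<in> C \<Longrightarrow> X i \<in> sets M"
  shows "emeasure M (\<Union>i\<in>C. X i) \<le> (\<integral>\<^sup>+i. emeasure M (X i) \<partial>count_space C)"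
proof -
  have "emeasure M (\<Union>i\<in>C. X i) = (\<integral>\<^sup>+x. indicator (\<Union>i\<in>C. X i) x \<partial>M)"
    using C X by (intro nn_integral_indicator[symmetric]) auto
  also have "\<dots> \<le> (\<integral>\<^sup>+x. \<integral>\<^sup>+i. indicator (X i) x \<partial>count_space C \<partial>M)"
  proof (intro nn_integral_mono)
    fix x show "indicator (\<Union>i\<in>C. X i) x \<le> (\<integral>\<^sup>+i. indicator (X i) x \<partial>count_space C :: ennreal)"
    proof (cases "x \<in> (\<Union>i\<in>C. X i)")
      case True
      then obtain j where "j \<in> C" "x \<in> X j" by blast
      then show ?thesis using nn_integral_ge_point[of j C "\<lambda>i. indicator (X i) x"] True by simp
    qed simp
  qed
  also have "\<dots> = (\<integral>\<^sup>+i. \<integral>\<^sup>+x. indicator (X i) x \<partial>M \<partial>count_space C)"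
    using C X by (intro nn_integral_count_space_nn_integral) auto
  also have "\<dots> = (\<integral>\<^sup>+i. emeasure M (X i) \<partial>count_space C)"
    using X by (intro nn_integral_cong) auto
  finally show ?thesis .
qed

text \<open>Integration against \<open>h\<close> is the measure \<open>density M h\<close>, so
  countable additivity turns the sum into one integral over the union, which lies in
  \<open>Y\<close>.\<close>

lemma nn_integral_disjoint_UN_le:
  assumes C: "countable C" and X: "\<And>i. i \<in> C \<Longrightarrow> X i \<in> sets M"
    and disj: "disjoint_family_on X C" and sub: "\<And>i. i \<in> C \<Longrightarrow> X i \<subseteq> Y"
    and [measurable]: "h \<in> borel_measurable M"
  shows "(\<integral>\<^sup>+i. (\<integral>\<^sup>+x\<in>X i. h x \<partial>M) \<partial>count_space C) \<le> (\<integral>\<^sup>+x\<in>Y. h x \<partial>M)"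
proof -
  have "(\<integral>\<^sup>+i. (\<integral>\<^sup>+x\<in>X i. h x \<partial>M) \<partial>count_space C) = (\<integral>\<^sup>+i. emeasure (density M h) (X i) \<partial>count_space C)"
    using X by (intro nn_integral_cong) (simp add: emeasure_density)
  also have "\<dots> = emeasure (density M h) (\<Union>i\<in>C. X i)"
    using C X disj by (intro emeasure_UN_countable[symmetric]) auto
  also have "\<dots> = (\<integral>\<^sup>+x\<in>(\<Union>i\<in>C. X i). h x \<partial>M)"
    using C X by (intro emeasure_density) auto
  also have "\<dots> \<le> (\<integral>\<^sup>+x\<in>Y. h x \<partial>M)"
    using sub by (intro nn_integral_mono mult_left_mono indicator_leI) auto
  finally show ?thesis .
qed

subsection \<open>Level sets of the maximal function\<close>

text \<open>The set where the uncentred maximal function of \<open>h\<close> exceeds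
  \<open>t\<close>. Writing it as a union of cubes allows extended-valued \<open>h\<close> and makes
  membership a statement about a single cube.\<close>

definition level :: "ennreal \<Rightarrow> (real ^ 'n \<Rightarrow> ennreal) \<Rightarrow> (real ^ 'n) set" where
  "level t h = \<Union>{Q \<in> cubes. t < average Q h}"

lemma less_average_cube:
  fixes a :: "real ^ 'n"
  assumes "0 < l"
  shows "t < average (cube a l) h \<longleftrightarrow> t * ennreal (l ^ CARD('n)) < (\<integral>\<^sup>+y\<in>cube a l. h y \<partial>lebesgue)"
  using assms by (simp add: average_def emeasure_cube less_divide_ennreal_real)

lemma mem_level: "x \<in> level t h \<longleftrightarrow> (\<exists>a l. 0 < l \<and> x \<in> cube a l \<and> t < average (cube a l) h)"
  by (auto simp: level_def cubes_eq)

lemma level_mono: "(\<And>y. h y \<le> k y) \<Longrightarrow> s \<le> t \<Longrightarrow> level t h \<subseteq> level s k"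
proof
  fix x assume *: "\<And>y. h y \<le> k y" "s \<le> t" and "x \<in> level t h"
  then obtain Q where Q: "Q \<in> cubes" "x \<in> Q" "t < average Q h" by (auto simp: level_def)
  have "average Q h \<le> average Q k"
    unfolding average_def using *(1) by (intro divide_right_mono_ennreal nn_integral_mono mult_right_mono) auto
  then show "x \<in> level s k" using Q * by (auto simp: level_def intro: le_less_trans less_le_trans)
qed

text \<open>The strict inequality survives a slight enlargement of the closed cube, and the enlarged
  cube contains an open box about the point. Openness is what makes these sets measurable.\<close>

lemma open_level: "open (level t (h :: real ^ 'n \<Rightarrow> ennreal))"
proof (subst open_subopen, intro ballI)
  fix x assume "x \<in> level t h"
  then obtain a l where l: "0 < l" and x: "x \<in> cube a l" and "t < average (cube a l) h"
    unfolding mem_level by blast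
  define I where "I = (\<integral>\<^sup>+y\<in>cube a l. h y \<partial>lebesgue)"
  have tI: "t * ennreal (l ^ CARD('n)) < I"
    using \<open>t < average (cube a l) h\<close> l by (simp add: less_average_cube I_def)
  \<comment> \<open>This limit needs \<open>t\<close> to be finite, which it is because it lies
    strictly below an average.\<close>
  have "((\<lambda>e. t * ennreal ((l + 2 * e) ^ CARD('n))) \<longlongrightarrow> t * ennreal ((l + 2 * 0) ^ CARD('n))) (at_right 0)"
    using \<open>t < average (cube a l) h\<close>
    by (intro ennreal_tendsto_cmult tendsto_ennrealI tendsto_intros) (auto intro: less_le_trans)
  then have "\<forall>\<^sub>F e in at_right 0. t * ennreal ((l + 2 * e) ^ CARD('n)) < I"
    using tI by (intro order_tendstoD(2)) auto
  then obtain e where e: "0 < e" "t * ennreal ((l + 2 * e) ^ CARD('n)) < I"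
    unfolding eventually_at_right_field by (metis field_lbound_gt_zero dense)
  define Q where "Q = cube (a - vec e) (l + 2 * e)"
  have "cube a l \<subseteq> Q" using e(1) by (auto simp: Q_def mem_cube) (smt (verit))+
  then have "I \<le> (\<integral>\<^sup>+y\<in>Q. h y \<partial>lebesgue)"
    unfolding I_def by (intro nn_integral_mono mult_left_mono indicator_leI) auto
  with e l have "t < average Q h"
    unfolding Q_def by (subst less_average_cube) auto
  then have "Q \<subseteq> level t h"
    using cube_in_cubes[of "l + 2 * e" "a - vec e"] e l unfolding Q_def level_def by fastforce
  moreover have "box (a - vec e) (a + vec (l + e)) \<subseteq> Q"
  proof
    fix y assume "y \<in> box (a - vec e) (a + vec (l + e))"
    then have "a $ i - e < y $ i \<and> y $ i < a $ i + (l + e)" for i by (simp add: mem_box_cart)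
    then show "y \<in> Q" unfolding Q_def mem_cube by (smt (verit) vec_component vector_minus_component)
  qed
  moreover have "x \<in> box (a - vec e) (a + vec (l + e))"
    using x e(1) unfolding mem_cube mem_box_cart
    by (smt (verit) vec_component vector_add_component vector_minus_component)
  ultimately show "\<exists>T. open T \<and> x \<in> T \<and> T \<subseteq> level t h" by (meson open_box order_trans)
qed

lemma level_sets_lebesgue [measurable, simp]: "level t h \<in> sets lebesgue"
  using open_level[of t h] by auto

text \<open>From \<open>t * l ^ CARD('n) \<le> H\<close> and \<open>l \<le> l ^ CARD('n)\<close> for
  sides above 1; the \<open>max 1\<close> replaces an n-th root. This supplies the bound on the
  sides demanded by the covering lemma.\<close>

lemma side_le_if_average_gt:
  fixes a :: "real ^ 'n"
  assumes t: "0 < t" and l: "0 < l" and av: "ennreal t < average (cube a l) h"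
    and H: "(\<integral>\<^sup>+y. h y \<partial>lebesgue) \<le> ennreal H" "0 \<le> H"
  shows "l \<le> max 1 (H / t)"
proof (cases "l \<le> 1")
  case False
  have "ennreal (t * l ^ CARD('n)) \<le> (\<integral>\<^sup>+y\<in>cube a l. h y \<partial>lebesgue)"
    using av t l by (simp add: less_average_cube ennreal_mult)
  also have "\<dots> \<le> (\<integral>\<^sup>+y. h y \<partial>lebesgue)"
    by (intro nn_integral_mono) (auto simp: indicator_def)
  also note H(1)
  finally have "t * l ^ CARD('n) \<le> H" using H(2) by simp
  moreover have "l \<le> l ^ CARD('n)" using False by (intro self_le_power) auto
  ultimately have "t * l \<le> H" using t by (meson mult_left_mono less_imp_le order_trans)
  then show ?thesis using t by (simp add: field_simps le_max_iff_disj)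
qed simp

text \<open>The constant is the volume ratio of dilate and cube: the dilates of the selected cubes
  cover the level set, while the cubes are disjoint and each satisfies \<open>t * |Q| \<le>\<close>
  integral of \<open>h\<close> over \<open>Q\<close>. An infinite integral makes the bound trivial
  and is set apart because the side bound needs a finite one.\<close>

lemma level_weak_type:
  fixes h :: "real ^ 'n \<Rightarrow> ennreal"
  assumes [measurable]: "h \<in> borel_measurable lebesgue" and t: "0 < t"
  shows "ennreal t * emeasure lebesgue (level (ennreal t) h)
    \<le> ennreal ((10 * real CARD('n)) ^ CARD('n)) * (\<integral>\<^sup>+y. h y \<partial>lebesgue)"
proof (cases "(\<integral>\<^sup>+y. h y \<partial>lebesgue)")
  case (real H)
  define D where "D = ennreal ((10 * real CARD('n)) ^ CARD('n))"
  define I where "I = {(a, l). 0 < l \<and> ennreal t < average (cube a l) h}"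
  have less: "ennreal t * emeasure lebesgue (cube a l) \<le> (\<integral>\<^sup>+y\<in>cube a l. h y \<partial>lebesgue)"
    if "(a, l) \<in> I" for a l
    using that by (auto simp: I_def less_average_cube emeasure_cube dest: less_imp_le)
  have bd: "0 < snd i \<and> snd i \<le> max 1 (H / t)" if "i \<in> I" for i
    using side_le_if_average_gt[OF t, of "snd i" "fst i" h H] real that by (auto simp: I_def)
  obtain C where C: "countable C" "C \<subseteq> I" "disjoint_family_on (\<lambda>i. cube (fst i) (snd i)) C"
    "(\<Union>i\<in>I. cube (fst i) (snd i)) \<subseteq> (\<Union>i\<in>C. dilate (fst i) (snd i))"
    by (rule vitali_cubes[of I snd "max 1 (H / t)" fst, OF bd])
  have "level (ennreal t) h \<subseteq> (\<Union>i\<in>C. dilate (fst i) (snd i))"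
  proof
    fix x assume "x \<in> level (ennreal t) h"
    then obtain a l where "(a, l) \<in> I" "x \<in> cube a l" by (auto simp: mem_level I_def)
    then have "x \<in> (\<Union>i\<in>I. cube (fst i) (snd i))" by (intro UN_I[of "(a, l)"]) auto
    then show "x \<in> (\<Union>i\<in>C. dilate (fst i) (snd i))" using C(4) by (rule rev_subsetD)
  qed
  then have "emeasure lebesgue (level (ennreal t) h) \<le> emeasure lebesgue (\<Union>i\<in>C. dilate (fst i) (snd i))"
    using C(1) by (intro emeasure_mono) (auto simp: dilate_def)
  also have "\<dots> \<le> (\<integral>\<^sup>+i. emeasure lebesgue (dilate (fst i) (snd i)) \<partial>count_space C)"
    using C(1) by (intro emeasure_UN_le_nn_integral) (auto simp: dilate_def)
  finally have "ennreal t * emeasure lebesgue (level (ennreal t) h)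
    \<le> ennreal t * (\<integral>\<^sup>+i. emeasure lebesgue (dilate (fst i) (snd i)) \<partial>count_space C)"
    by (intro mult_left_mono) auto
  also have "\<dots> = (\<integral>\<^sup>+i. ennreal t * emeasure lebesgue (dilate (fst i) (snd i)) \<partial>count_space C)"
    by (simp add: nn_integral_cmult)
  also have "\<dots> \<le> (\<integral>\<^sup>+i. D * (\<integral>\<^sup>+y\<in>cube (fst i) (snd i). h y \<partial>lebesgue) \<partial>count_space C)"
  proof (intro nn_integral_mono)
    fix i assume "i \<in> space (count_space C)"
    then have i: "(fst i, snd i) \<in> I" using C(2) by auto
    then have "0 \<le> snd i" by (auto simp: I_def)
    then have "ennreal t * emeasure lebesgue (dilate (fst i) (snd i))
       = D * (ennreal t * emeasure lebesgue (cube (fst i) (snd i)))"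
      by (simp add: emeasure_dilate D_def mult_ac)
    also have "\<dots> \<le> D * (\<integral>\<^sup>+y\<in>cube (fst i) (snd i). h y \<partial>lebesgue)"
      using less[OF i] by (rule mult_left_mono) simp
    finally show "ennreal t * emeasure lebesgue (dilate (fst i) (snd i))
       \<le> D * (\<integral>\<^sup>+y\<in>cube (fst i) (snd i). h y \<partial>lebesgue)" .
  qed
  also have "\<dots> = D * (\<integral>\<^sup>+i. (\<integral>\<^sup>+y\<in>cube (fst i) (snd i). h y \<partial>lebesgue) \<partial>count_space C)"
    by (simp add: nn_integral_cmult)
  also have "\<dots> \<le> D * (\<integral>\<^sup>+y\<in>UNIV. h y \<partial>lebesgue)"
    using C(1,3) by (intro mult_left_mono nn_integral_disjoint_UN_le) auto
  finally show ?thesis by (simp add: D_def)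
next
  case top
  then show ?thesis by (simp add: ennreal_mult_top)
qed

subsection \<open>Linear images and substitutions\<close>

(* The library computes the measure of linear images only for well-ordered index types; a one-sided
   bound holds for every finite index type and is all that is needed. *)
lemma linear_image_open_cover:
  fixes T :: "real ^ 'n \<Rightarrow> real ^ 'n"
  assumes T: "linear T"
  obtains C where "0 < C" "\<And>U. open U \<Longrightarrow> \<exists>V\<in>sets lebesgue. T ` U \<subseteq> V \<and> emeasure lebesgue V \<le> ennreal C * emeasure lebesgue U"
proof -
  obtain B where B: "0 < B" "\<And>x. norm (T x) \<le> B * norm x"
    using linear_bounded_pos[OF T] by blast
  define n where "n = real CARD('n)"
  have n: "0 < n" by (simp add: n_def)
  \<comment> \<open>A point of a dilate lies within \<open>n * (10 * n * l)\<close> of the dilate's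
    corner, so its image lies within \<open>B\<close> times that of the image of the corner; a cube
    with twice this as side contains the whole image.\<close>
  define K where "K = 2 * (B * (n * (10 * n)))"
  define C where "C = K ^ CARD('n)"
  have K: "0 < K" using B n by (simp add: K_def)
  define W where "W a l = cube (T (a - vec (5 * n * l)) - vec (B * (n * (10 * n * l)))) (K * l)" for a l
  have cov: "T ` dilate a l \<subseteq> W a l" if "0 < l" for a l
  proof
    fix y assume "y \<in> T ` dilate a l"
    then obtain x where x: "x \<in> dilate a l" "y = T x" by blast
    define b where "b = a - vec (5 * n * l)"
    have "x \<in> cball b (n * (10 * n * l))"
      using x(1) that cube_subset_cball[of "10 * n * l" b] n
      unfolding dilate_def b_def n_def by auto
    then have "norm (x - b) \<le> n * (10 * n * l)" by (simp add: dist_norm norm_minus_commute)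
    then have "norm (T x - T b) \<le> B * (n * (10 * n * l))"
      using B(2)[of "x - b"] B(1) by (simp add: linear_diff[OF T]) (meson mult_left_mono less_imp_le order_trans)
    then have "\<bar>T x $ i - T b $ i\<bar> \<le> B * (n * (10 * n * l))" for i
      using component_le_norm_cart[of "T x - T b" i] by simp
    note bd = this
    have Kl: "K * l = 2 * (B * (n * (10 * n * l)))" by (simp add: K_def)
    show "y \<in> W a l"
      unfolding W_def mem_cube b_def[symmetric] x(2) Kl
    proof
      fix i
      show "(T b - vec (B * (n * (10 * n * l)))) $ i \<le> T x $ i \<and>
        T x $ i \<le> (T b - vec (B * (n * (10 * n * l)))) $ i + 2 * (B * (n * (10 * n * l)))"
        using bd[of i] unfolding abs_le_iff vector_minus_component vec_component by linarith
    qed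
  qed
  have W: "emeasure lebesgue (W a l) = ennreal C * emeasure lebesgue (cube a l)" if "0 < l" for a l
    using that K by (simp add: W_def emeasure_cube C_def power_mult_distrib ennreal_mult[symmetric])
  show thesis
  proof (rule that[of C])
    show "0 < C" using K by (simp add: C_def)
    fix U :: "(real ^ 'n) set" assume U: "open U"
    \<comment> \<open>The cap \<open>l \<le> 1\<close> serves the covering lemma. The selected cubes
      are disjoint subsets of \<open>U\<close>, so their total volume can be charged to
      \<open>U\<close>.\<close>
    define I where "I = {(a, l). 0 < l \<and> l \<le> 1 \<and> cube a l \<subseteq> U}"
    have bd: "0 < snd i \<and> snd i \<le> 1" if "i \<in> I" for i
      using that by (auto simp: I_def)
    obtain J where J: "countable J" "J \<subseteq> I" "disjoint_family_on (\<lambda>i. cube (fst i) (snd i)) J"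
      "(\<Union>i\<in>I. cube (fst i) (snd i)) \<subseteq> (\<Union>i\<in>J. dilate (fst i) (snd i))"
      by (rule vitali_cubes[of I snd 1 fst, OF bd])
    have "U \<subseteq> (\<Union>i\<in>I. cube (fst i) (snd i))"
    proof
      fix x assume "x \<in> U"
      then obtain e where e: "0 < e" "cball x e \<subseteq> U" using U open_contains_cball by blast
      define l where "l = min 1 (e / n)"
      have l: "0 < l" "l \<le> 1" "n * l \<le> e" using e n by (auto simp: l_def field_simps min_def)
      have "cube x l \<subseteq> U"
        using cube_subset_cball[of l x] l e(2) by (force simp: n_def)
      then have "(x, l) \<in> I" using l by (simp add: I_def)
      moreover have "x \<in> cube x l" using l by (simp add: mem_cube)
      ultimately show "x \<in> (\<Union>i\<in>I. cube (fst i) (snd i))" by force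
    qed
    from this J(4) have "U \<subseteq> (\<Union>i\<in>J. dilate (fst i) (snd i))" by (rule order_trans)
    then have "T ` U \<subseteq> (\<Union>i\<in>J. T ` dilate (fst i) (snd i))" by blast
    also have "\<dots> \<subseteq> (\<Union>i\<in>J. W (fst i) (snd i))"
      using J(2) by (intro UN_mono cov) (auto simp: I_def)
    finally have 1: "T ` U \<subseteq> (\<Union>i\<in>J. W (fst i) (snd i))" .
    have "emeasure lebesgue (\<Union>i\<in>J. W (fst i) (snd i)) \<le> (\<integral>\<^sup>+i. emeasure lebesgue (W (fst i) (snd i)) \<partial>count_space J)"
      using J(1) by (intro emeasure_UN_le_nn_integral) (auto simp: W_def)
    also have "\<dots> = (\<integral>\<^sup>+i. ennreal C * emeasure lebesgue (cube (fst i) (snd i)) \<partial>count_space J)"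
      using J(2) by (intro nn_integral_cong W) (auto simp: I_def)
    also have "\<dots> = ennreal C * emeasure lebesgue (\<Union>i\<in>J. cube (fst i) (snd i))"
      using J by (subst emeasure_UN_countable) (auto simp: nn_integral_cmult)
    also have "\<dots> \<le> ennreal C * emeasure lebesgue U"
    proof (intro mult_left_mono emeasure_mono UN_least)
      fix i assume "i \<in> J"
      from subsetD[OF J(2) this] show "cube (fst i) (snd i) \<subseteq> U" by (auto simp: I_def)
    qed (use U in auto)
    finally have 2: "emeasure lebesgue (\<Union>i\<in>J. W (fst i) (snd i)) \<le> ennreal C * emeasure lebesgue U" .
    have 3: "(\<Union>i\<in>J. W (fst i) (snd i)) \<in> sets lebesgue"
      using J(1) by (intro sets.countable_UN'') (auto simp: W_def)
    from 1 2 3 show "\<exists>V\<in>sets lebesgue. T ` U \<subseteq> V \<and> emeasure lebesgue V \<le> ennreal C * emeasure lebesgue U" by blast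
  qed
qed

lemma linear_image_sets_lebesgue:
  fixes T :: "real ^ 'n \<Rightarrow> real ^ 'n"
  assumes "linear T" "S \<in> sets lebesgue" shows "T ` S \<in> sets lebesgue"
  using assms by (intro differentiable_image_in_sets_lebesgue) (auto intro: linear_imp_differentiable_on)

text \<open>By outer regularity \<open>E\<close> sits in an open set of excess measure below
  \<open>e / C\<close>, so the bound for open sets costs only an extra \<open>e\<close>.\<close>

lemma emeasure_linear_image_le:
  fixes T :: "real ^ 'n \<Rightarrow> real ^ 'n"
  assumes T: "linear T"
  obtains C where "0 < C" "\<And>E. E \<in> sets lebesgue \<Longrightarrow> emeasure lebesgue (T ` E) \<le> ennreal C * emeasure lebesgue E"
proof -
  from linear_image_open_cover[OF T] obtain C where C: "0 < C"
    "\<And>U. open U \<Longrightarrow> \<exists>V\<in>sets lebesgue. T ` U \<subseteq> V \<and> emeasure lebesgue V \<le> ennreal C * emeasure lebesgue U"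
    by metis
  show thesis
  proof (rule that[OF C(1)])
    fix E :: "(real ^ 'n) set" assume E: "E \<in> sets lebesgue"
    show "emeasure lebesgue (T ` E) \<le> ennreal C * emeasure lebesgue E"
    proof (rule ennreal_le_epsilon)
      fix e :: real assume e: "0 < e"
      then have "0 < e / C" using C(1) by simp
      from sets_lebesgue_outer_open[OF E this] obtain U where U: "open U" "E \<subseteq> U"
        "U - E \<in> lmeasurable" "emeasure lebesgue (U - E) < ennreal (e / C)" .
      from C(2)[OF U(1)] obtain V where V: "V \<in> sets lebesgue" "T ` U \<subseteq> V"
        "emeasure lebesgue V \<le> ennreal C * emeasure lebesgue U" by blast
      have "emeasure lebesgue (T ` E) \<le> emeasure lebesgue V"
        using U(2) V by (intro emeasure_mono) auto
      also note V(3)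
      also have "emeasure lebesgue U = emeasure lebesgue E + emeasure lebesgue (U - E)"
        using E U by (subst plus_emeasure) (auto intro!: arg_cong[where f="emeasure lebesgue"])
      also have "\<dots> \<le> emeasure lebesgue E + ennreal (e / C)"
        using U(4) by (intro add_left_mono) simp
      also have "ennreal C * (emeasure lebesgue E + ennreal (e / C)) = ennreal C * emeasure lebesgue E + ennreal e"
        using C(1) e by (simp add: distrib_left ennreal_mult[symmetric])
      finally show "emeasure lebesgue (T ` E) \<le> ennreal C * emeasure lebesgue E + ennreal e"
        by (simp add: mult_left_mono)
    qed
  qed
qed

lemma
  fixes A :: "real ^ 'n ^ 'n"
  assumes "invertible A"
  shows matrix_inv_right: "A ** matrix_inv A = mat 1" and matrix_inv_left: "matrix_inv A ** A = mat 1"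
  using someI_ex[OF assms[unfolded invertible_def]] by (simp_all add: matrix_inv_def)

lemma invertible_matrix_vector_inv:
  fixes A :: "real ^ 'n ^ 'n"
  assumes "invertible A"
  shows "matrix_inv A *v (A *v x) = x" "A *v (matrix_inv A *v x) = x"
  using assms by (simp_all add: matrix_vector_mul_assoc matrix_inv_left matrix_inv_right)

lemma invertible_matrix_inv:
  fixes A :: "real ^ 'n ^ 'n"
  shows "invertible A \<Longrightarrow> invertible (matrix_inv A)"
  by (meson invertible_def matrix_inv_left matrix_inv_right)

text \<open>Preimages under \<open>A\<close> are images under the inverse, so the measure bound for
  linear images says that the push-forward of Lebesgue measure by \<open>A\<close> is at most
  \<open>C\<close> times Lebesgue measure. This stands in for the change of variables formula,
  without the determinant.\<close>

lemma nn_integral_linear_le: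
  fixes A :: "real ^ 'n ^ 'n"
  assumes A: "invertible A"
  shows measurable_matrix_vector_mult_lebesgue: "(*v) A \<in> lebesgue \<rightarrow>\<^sub>M lebesgue"
    and "\<exists>C::real. 0 < C \<and> (\<forall>h\<in>borel_measurable lebesgue. (\<integral>\<^sup>+x. h (A *v x) \<partial>lebesgue) \<le> ennreal C * (\<integral>\<^sup>+x. h x \<partial>lebesgue))"
proof -
  have vim: "(*v) A -` S = (*v) (matrix_inv A) ` S" for S
    using invertible_matrix_vector_inv[OF A] by (auto simp: image_iff) metis
  show m: "(*v) A \<in> lebesgue \<rightarrow>\<^sub>M lebesgue"
    by (rule measurableI) (auto simp: vim intro!: linear_image_sets_lebesgue)
  obtain C where C: "0 < C" "\<And>E. E \<in> sets lebesgue \<Longrightarrow> emeasure lebesgue ((*v) (matrix_inv A) ` E) \<le> ennreal C * emeasure lebesgue E"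
    by (rule emeasure_linear_image_le[of "(*v) (matrix_inv A)"]) auto
  show "\<exists>C::real. 0 < C \<and> (\<forall>h\<in>borel_measurable lebesgue. (\<integral>\<^sup>+x. h (A *v x) \<partial>lebesgue) \<le> ennreal C * (\<integral>\<^sup>+x. h x \<partial>lebesgue))"
  proof (intro exI conjI ballI)
    fix h :: "real ^ 'n \<Rightarrow> ennreal" assume h: "h \<in> borel_measurable lebesgue"
    have "(\<integral>\<^sup>+x. h (A *v x) \<partial>lebesgue) = (\<integral>\<^sup>+x. h x \<partial>distr lebesgue lebesgue ((*v) A))"
      using m h by (simp add: nn_integral_distr)
    also have "\<dots> \<le> (\<integral>\<^sup>+x. h x \<partial>scale_measure (ennreal C) lebesgue)"
    proof (rule nn_integral_mono_measure)
      show "distr lebesgue lebesgue ((*v) A) \<le> scale_measure (ennreal C) lebesgue"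
        using C(2) m by (subst le_measure) (auto simp: le_fun_def emeasure_distr vim emeasure_notin_sets)
    qed simp
    also have "\<dots> = ennreal C * (\<integral>\<^sup>+x. h x \<partial>lebesgue)"
      using h by (simp add: nn_integral_scale_measure)
    finally show "(\<integral>\<^sup>+x. h (A *v x) \<partial>lebesgue) \<le> ennreal C * (\<integral>\<^sup>+x. h x \<partial>lebesgue)" .
  qed fact
qed

subsection \<open>Layer sums\<close>

text \<open>One term of the sum already dominates: it is enough to find \<open>i\<close> in
  \<open>S\<close> with \<open>m \<le> B * b * b powr i\<close>. The form of \<open>S\<close> is
  left open so that the lemma serves both the levels of the maximal function and the Orlicz
  layers.\<close>

lemma ennreal_powr_le_layer_sum:
  fixes b p m B :: real and S :: "int set"
  assumes b: "1 < b" and p: "0 < p" and m: "0 \<le> m" and B: "0 < B"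
    and S: "\<And>i. i \<notin> S \<Longrightarrow> m \<le> B * b powr i"
  shows "ennreal (m powr p) \<le> ennreal ((B * b) powr p) *
    (\<integral>\<^sup>+i. ennreal (b powr (real_of_int i * p)) * indicator S i \<partial>count_space UNIV)"
proof (cases "m = 0")
  case True
  then show ?thesis by simp
next
  case False
  with m have m: "0 < m" by simp
  define u where "u = log b (m / B)"
  have u: "B * b powr u = m" using b m B by (simp add: u_def)
  have "\<exists>i\<in>S. m \<le> B * b * b powr i"
  \<comment> \<open>Either some index of \<open>S\<close> has its successor outside, and the
    hypothesis at the successor gives the bound, or \<open>S\<close> is closed under successors, and
    then \<open>\<lfloor>u\<rfloor>\<close> lies in it.\<close>
  proof (cases "\<exists>i\<in>S. i + 1 \<notin> S")
    case True
    then obtain i where "i \<in> S" "i + 1 \<notin> S" by blast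
    with S[of "i + 1"] b show ?thesis by (auto simp: powr_add mult_ac)
  next
    case step: False
    \<comment> \<open>The shift by 1 makes
      \<open>b powr (\<lfloor>u\<rfloor> - 1) < b powr u\<close> strict even if \<open>u\<close> is
      an integer; the successor step then recovers \<open>\<lfloor>u\<rfloor>\<close>.\<close>
    have "\<lfloor>u\<rfloor> - 1 \<in> S"
    proof (rule ccontr)
      assume "\<lfloor>u\<rfloor> - 1 \<notin> S"
      then have "m \<le> B * b powr (\<lfloor>u\<rfloor> - 1)" using S by blast
      moreover have "b powr (\<lfloor>u\<rfloor> - 1) < b powr u" using b by (intro powr_less_mono) linarith+
      ultimately have "m < B * b powr u" using B by (meson le_less_trans mult_strict_left_mono)
      with u show False by simp
    qed
    then have "\<lfloor>u\<rfloor> \<in> S" using step by force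
    moreover have "b powr u \<le> b powr (1 + \<lfloor>u\<rfloor>)" using b by (intro powr_mono) linarith+
    then have "m \<le> B * b * b powr \<lfloor>u\<rfloor>" using u B b by (simp add: powr_add) (metis less_imp_le mult.assoc mult_left_mono)
    ultimately show ?thesis by blast
  qed
  then obtain i where i: "i \<in> S" "m \<le> B * b * b powr i" by blast
  then have "m powr p \<le> (B * b * b powr i) powr p" using m p by (intro powr_mono2) auto
  also have "\<dots> = (B * b) powr p * b powr (i * p)" using B b by (simp add: powr_mult powr_powr)
  finally have "ennreal (m powr p) \<le> ennreal ((B * b) powr p) * ennreal (b powr (i * p))"
    by (simp add: ennreal_mult[symmetric])
  also have "ennreal (b powr (i * p)) \<le> (\<integral>\<^sup>+i. ennreal (b powr (real_of_int i * p)) * indicator S i \<partial>count_space UNIV)"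
    using nn_integral_ge_point[of i UNIV "\<lambda>i. ennreal (b powr (real_of_int i * p)) * indicator S i"] i(1) by simp
  finally show ?thesis by (simp add: mult_left_mono)
qed

lemma epowr_le_layer_sum:
  fixes b p :: real
  assumes b: "1 < b" and p: "0 < p"
  shows "epowr v p \<le> ennreal (b powr p) *
    (\<integral>\<^sup>+i. ennreal (b powr (real_of_int i * p)) * indicator {i::int. ennreal (b powr i) < v} i \<partial>count_space UNIV)"
proof (cases v)
  case (real r)
  have "ennreal (r powr p) \<le> ennreal ((1 * b) powr p) *
    (\<integral>\<^sup>+i. ennreal (b powr (real_of_int i * p)) * indicator {i::int. ennreal (b powr i) < v} i \<partial>count_space UNIV)"
    using real b p by (intro ennreal_powr_le_layer_sum) (auto simp: ennreal_less_iff)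
  then show ?thesis using real by (simp add: epowr_def)
next
  case top
  let ?R = "ennreal (b powr p) *
    (\<integral>\<^sup>+i. ennreal (b powr (real_of_int i * p)) * indicator {i::int. ennreal (b powr i) < v} i \<partial>count_space UNIV)"
  \<comment> \<open>For \<open>v = top\<close> every index belongs to the layer set, so the bound
    holds for all \<open>m\<close> and the sum cannot be finite.\<close>
  have *: "ennreal (m powr p) \<le> ?R" if "0 \<le> m" for m
    using ennreal_powr_le_layer_sum[of b p m 1 "{i::int. ennreal (b powr i) < v}"] that b p top by simp
  have "?R = top"
  proof (rule ccontr)
    assume "?R \<noteq> top"
    then obtain r where r: "0 \<le> r" "?R = ennreal r" by (cases ?R) auto
    have "ennreal (((r + 1) powr (1 / p)) powr p) \<le> ennreal r"
      using *[of "(r + 1) powr (1 / p)"] r by simp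
    then show False using r p by (simp add: powr_powr)
  qed
  then show ?thesis by simp
qed

text \<open>With \<open>z = y / 2 powr k > 1\<close>, monotonicity bounds
  \<open>\<psi> t / t powr (p + 1)\<close> on \<open>[z, 2 * z)\<close> below by
  \<open>\<psi> z / (2 * z) powr (p + 1)\<close>, and the interval has length \<open>z\<close>; the
  product is the k-th term up to the factor \<open>2 powr (p + 1) * y powr p\<close>. These
  intervals are disjoint in k and lie in \<open>{1..}\<close>, the range of the B_p
  integral.\<close>

lemma dyadic_sum_le_integral:
  fixes \<psi> :: "real \<Rightarrow> real"
  assumes cont: "continuous_on UNIV \<psi>" and mono: "mono_on {0..} \<psi>" and nonneg: "\<And>t. 0 \<le> \<psi> t"
    and p: "0 < p" and y: "0 \<le> y"
  shows "(\<integral>\<^sup>+k. ennreal (2 powr (real_of_int k * p) * \<psi> (y / 2 powr k)) * indicator {k::int. 2 powr k < y} k \<partial>count_space UNIV)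
    \<le> ennreal (2 powr (p + 1) * y powr p) * (\<integral>\<^sup>+t\<in>{1..}. ennreal (\<psi> t / t powr (p + 1)) \<partial>lborel)"
proof -
  define S where "S = {k::int. 2 powr k < y}"
  define A where "A k = {y / 2 powr real_of_int k ..< 2 * (y / 2 powr k)}" for k
  have [measurable]: "\<psi> \<in> borel_measurable borel" using cont by (rule borel_measurable_continuous_onI)
  have A: "ennreal (2 powr (real_of_int k * p) * \<psi> (y / 2 powr k))
    \<le> ennreal (2 powr (p + 1) * y powr p) * (\<integral>\<^sup>+t\<in>A k. ennreal (\<psi> t / t powr (p + 1)) \<partial>lborel)"
    if "k \<in> S" for k
  proof -
    define z where "z = y / 2 powr k"
    have z: "1 < z" using that by (simp add: z_def S_def)
    have y: "y = z * 2 powr k" by (simp add: z_def)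
    have "ennreal (\<psi> z / (2 * z) powr (p + 1)) * emeasure lborel {z ..< 2 * z}
      = (\<integral>\<^sup>+t\<in>{z..<2*z}. ennreal (\<psi> z / (2 * z) powr (p + 1)) \<partial>lborel)"
      by (simp add: nn_integral_cmult_indicator)
    also have "\<dots> \<le> (\<integral>\<^sup>+t\<in>A k. ennreal (\<psi> t / t powr (p + 1)) \<partial>lborel)"
    proof (intro nn_integral_mono)
      fix t
      show "ennreal (\<psi> z / (2 * z) powr (p + 1)) * indicator {z..<2*z} t
        \<le> ennreal (\<psi> t / t powr (p + 1)) * indicator (A k) t"
      proof (cases "t \<in> {z..<2*z}")
        case True
        have "\<psi> z \<le> \<psi> t" using mono_onD[OF mono] z True by auto
        moreover have "t powr (p + 1) \<le> (2 * z) powr (p + 1)" using z True p by (intro powr_mono2) auto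
        ultimately have "\<psi> z / (2 * z) powr (p + 1) \<le> \<psi> t / t powr (p + 1)"
          using z True nonneg by (intro frac_le) auto
        then show ?thesis using True by (auto simp: A_def z_def intro!: ennreal_leI)
      qed simp
    qed
    finally have *: "ennreal (\<psi> z / (2 * z) powr (p + 1) * z) \<le> (\<integral>\<^sup>+t\<in>A k. ennreal (\<psi> t / t powr (p + 1)) \<partial>lborel)"
      using z nonneg by (simp add: ennreal_mult[symmetric])
    have "2 powr (real_of_int k * p) * \<psi> z = 2 powr (p + 1) * y powr p * (\<psi> z / (2 * z) powr (p + 1) * z)"
      using z by (simp add: y powr_mult powr_powr powr_add field_simps)
    then have "ennreal (2 powr (real_of_int k * p) * \<psi> z)
      = ennreal (2 powr (p + 1) * y powr p) * ennreal (\<psi> z / (2 * z) powr (p + 1) * z)"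
      using z nonneg by (subst ennreal_mult[symmetric]) auto
    also have "\<dots> \<le> ennreal (2 powr (p + 1) * y powr p) * (\<integral>\<^sup>+t\<in>A k. ennreal (\<psi> t / t powr (p + 1)) \<partial>lborel)"
      using * by (rule mult_left_mono) simp
    finally show ?thesis by (simp add: z_def)
  qed
  have A_sub: "A k \<subseteq> {1..}" if "k \<in> S" for k
  proof -
    have "1 \<le> y / 2 powr k" using that by (simp add: S_def)
    then show ?thesis
      unfolding A_def subset_eq Ball_def atLeastLessThan_iff atLeast_iff by (meson order_trans)
  qed
  have A_sets: "A k \<in> sets borel" for k by (simp add: A_def)
  have disj: "disjoint_family_on A S"
    unfolding disjoint_family_on_def
  proof (intro ballI impI)
    have less: "A j \<inter> A k = {}" if "j \<in> S" "j < k" for j k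
    proof -
      have "2 * 2 powr j = 2 powr (real_of_int j + 1)" by (simp add: powr_add)
      also have "\<dots> \<le> 2 powr k" using that by (intro powr_mono) auto
      finally have "2 * (y / 2 powr k) \<le> y / 2 powr j" using y by (simp add: field_simps mult_left_mono)
      then show ?thesis by (auto simp: A_def)
    qed
    fix j k assume "j \<in> S" "k \<in> S" "j \<noteq> k"
    then show "A j \<inter> A k = {}" using less[of j k] less[of k j] by (cases "j < k") auto
  qed
  have "(\<integral>\<^sup>+k. ennreal (2 powr (real_of_int k * p) * \<psi> (y / 2 powr k)) * indicator S k \<partial>count_space UNIV)
    = (\<integral>\<^sup>+k. ennreal (2 powr (real_of_int k * p) * \<psi> (y / 2 powr k)) \<partial>count_space S)"
    by (simp add: nn_integral_count_space_indicator)
  also have "\<dots> \<le> (\<integral>\<^sup>+k. ennreal (2 powr (p + 1) * y powr p) * (\<integral>\<^sup>+t\<in>A k. ennreal (\<psi> t / t powr (p + 1)) \<partial>lborel) \<partial>count_space S)"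
    by (intro nn_integral_mono A) simp
  also have "\<dots> = ennreal (2 powr (p + 1) * y powr p) * (\<integral>\<^sup>+k. (\<integral>\<^sup>+t\<in>A k. ennreal (\<psi> t / t powr (p + 1)) \<partial>lborel) \<partial>count_space S)"
    by (simp add: nn_integral_cmult)
  also have "\<dots> \<le> ennreal (2 powr (p + 1) * y powr p) * (\<integral>\<^sup>+t\<in>{1..}. ennreal (\<psi> t / t powr (p + 1)) \<partial>lborel)"
    using disj A_sub by (intro mult_left_mono nn_integral_disjoint_UN_le) (auto simp: A_sets)
  finally show ?thesis by (simp add: S_def)
qed

(* Dyadic layer sum standing in for (M_psi g)^p, where M_psi is the maximal operator of
   Luxemburg averages: the level set below is where some cube around x has
   Luxemburg psi-average of g above 2^i. Summing over layers avoids measurability of M_psi g. *)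
definition orlicz_layers :: "real \<Rightarrow> (real \<Rightarrow> real) \<Rightarrow> (real ^ 'n \<Rightarrow> real) \<Rightarrow> real ^ 'n \<Rightarrow> ennreal" where
  "orlicz_layers p \<psi> g x = (\<integral>\<^sup>+i. ennreal (2 powr (real_of_int i * p)) *
     indicator (level 1 (\<lambda>y. ennreal (\<psi> (g y / 2 powr i)))) x \<partial>count_space UNIV)"

section \<open>Strong type bound for the Orlicz layers under the B_p condition\<close>

lemma borel_measurable_count_space_nn_integral:
  assumes "\<And>i. f i \<in> borel_measurable M"
  shows "(\<lambda>x. \<integral>\<^sup>+i. f i x \<partial>count_space (UNIV :: 'i::countable set)) \<in> borel_measurable M"
proof -
  interpret sigma_finite_measure "count_space (UNIV :: 'i set)"
    by (rule sigma_finite_measure_count_space)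
  have "(\<lambda>z. f (snd z) (fst z)) \<in> borel_measurable (M \<Otimes>\<^sub>M count_space UNIV)"
    by (rule measurable_compose_countable[where g=snd and f="\<lambda>i z. f i (fst z)"]) (use assms in measurable)
  then show ?thesis
    by (intro borel_measurable_nn_integral) (simp add: split_beta)
qed

lemma orlicz_layers_measurable [measurable]: "orlicz_layers p \<psi> g \<in> borel_measurable lebesgue"
  unfolding orlicz_layers_def[abs_def] by (intro borel_measurable_count_space_nn_integral) simp

text \<open>At height \<open>2 powr i\<close>, the points where \<open>g\<close> is at most
  \<open>c * 2 powr i\<close> contribute at most 1/2 to an average of
  \<open>\<psi> (g / 2 powr i)\<close>, so an average above 1 forces the remaining part
  \<open>h i\<close> to have average above 1/2. The weak (1,1) bound for \<open>h i\<close>, summed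
  over \<open>i\<close> under the integral, leaves a dyadic sum that the B_p integral
  controls.\<close>

lemma nn_integral_orlicz_layers_le:
  fixes \<psi> :: "real \<Rightarrow> real"
  assumes cont: "continuous_on UNIV \<psi>" and mono: "mono_on {0..} \<psi>" and nonneg: "\<And>t. 0 \<le> \<psi> t"
    and conv: "convex_on {0..} \<psi>" and zero: "\<psi> 0 = 0" and p: "0 < p"
    and Bp: "(\<integral>\<^sup>+t\<in>{1..}. ennreal (\<psi> t / t powr (p + 1)) \<partial>lborel) < \<infinity>"
  shows "\<exists>C>0. \<forall>g::real ^ 'n \<Rightarrow> real. g \<in> borel_measurable lebesgue \<longrightarrow> (\<forall>x. 0 \<le> g x) \<longrightarrow>
    (\<integral>\<^sup>+x. orlicz_layers p \<psi> g x \<partial>lebesgue) \<le> ennreal C * (\<integral>\<^sup>+x. ennreal (g x powr p) \<partial>lebesgue)"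
proof -
  have [measurable]: "\<psi> \<in> borel_measurable borel" using cont by (rule borel_measurable_continuous_onI)
  obtain J where J: "0 \<le> J" "(\<integral>\<^sup>+t\<in>{1..}. ennreal (\<psi> t / t powr (p + 1)) \<partial>lborel) = ennreal J"
    using Bp by (cases "\<integral>\<^sup>+t\<in>{1..}. ennreal (\<psi> t / t powr (p + 1)) \<partial>lborel") auto
  \<comment> \<open>Chosen so that convexity and \<open>\<psi> 0 = 0\<close> give
    \<open>\<psi> c \<le> c * \<psi> 1 \<le> 1 / 2\<close>; the summand 2 keeps the denominator
    positive when \<open>\<psi> 1 = 0\<close>.\<close>
  define c where "c = 1 / (2 + 2 * \<psi> 1)"
  have c: "0 < c" "c \<le> 1" using nonneg[of 1] by (auto simp: c_def)
  have "\<psi> ((1 - c) *\<^sub>R 0 + c *\<^sub>R 1) \<le> (1 - c) * \<psi> 0 + c * \<psi> 1"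
    using c by (intro convex_onD[OF conv]) auto
  also have "\<dots> \<le> 1 / 2" using nonneg[of 1] by (simp add: zero c_def field_simps)
  finally have c2: "\<psi> c \<le> 1 / 2" by simp
  define D where "D = (10 * real CARD('n)) ^ CARD('n)"
  have D: "0 < D" by (simp add: D_def)
  \<comment> \<open>The factor \<open>2 * D\<close> is the weak type constant at height 1/2; the
    \<open>+ 1\<close> keeps \<open>C\<close> positive when \<open>J = 0\<close>.\<close>
  define C where "C = 2 * D * (2 powr (p + 1) * (1 / c) powr p * J) + 1"
  have "0 < C" using c J D by (auto simp: C_def intro!: add_nonneg_pos)
  moreover {
    fix g :: "real ^ 'n \<Rightarrow> real" assume [measurable]: "g \<in> borel_measurable lebesgue" and g: "\<And>x. 0 \<le> g x"
    define U where "U i = level 1 (\<lambda>y. ennreal (\<psi> (g y / 2 powr real_of_int i)))" for i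
    define h where "h i y = ennreal (\<psi> (g y / 2 powr real_of_int i)) * indicator {y. c * 2 powr i < g y} y" for i y
    have [measurable]: "h i \<in> borel_measurable lebesgue" for i unfolding h_def by measurable
    have le: "ennreal (\<psi> (g y / 2 powr real_of_int i)) \<le> h i y + ennreal (1 / 2)" for i y
    proof (cases "c * 2 powr i < g y")
      case False
      then have "g y / 2 powr i \<le> c" by (simp add: field_simps)
      then have "\<psi> (g y / 2 powr i) \<le> \<psi> c" using g[of y] c by (intro mono_onD[OF mono]) auto
      with c2 have "ennreal (\<psi> (g y / 2 powr i)) \<le> ennreal (1 / 2)" by (intro ennreal_leI) simp
      with False show ?thesis by (simp add: h_def)
    qed (simp add: h_def)
    have sub: "U i \<subseteq> level (ennreal (1 / 2)) (h i)" for i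
    proof
      fix x assume "x \<in> U i"
      then obtain a l where l: "0 < l" "x \<in> cube a l"
        and av: "1 < average (cube a l) (\<lambda>y. ennreal (\<psi> (g y / 2 powr i)))"
        unfolding U_def mem_level by blast
      let ?L = "l ^ CARD('n)"
      have half: "ennreal (1 / 2) * ennreal ?L = ennreal (?L / 2)"
        using l by (subst ennreal_mult[symmetric]) auto
      have "ennreal ?L < (\<integral>\<^sup>+y\<in>cube a l. ennreal (\<psi> (g y / 2 powr i)) \<partial>lebesgue)"
        using av l by (simp add: less_average_cube)
      also have "\<dots> \<le> (\<integral>\<^sup>+y. h i y * indicator (cube a l) y + ennreal (1 / 2) * indicator (cube a l) y \<partial>lebesgue)"
        using le by (intro nn_integral_mono) (auto simp: indicator_def)
      also have "\<dots> = (\<integral>\<^sup>+y\<in>cube a l. h i y \<partial>lebesgue) + (\<integral>\<^sup>+y. ennreal (1 / 2) * indicator (cube a l) y \<partial>lebesgue)"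
        by (intro nn_integral_add) auto
      also have "(\<integral>\<^sup>+y. ennreal (1 / 2) * indicator (cube a l) y \<partial>lebesgue) = ennreal (?L / 2)"
        using l half by (simp add: nn_integral_cmult_indicator emeasure_cube)
      finally have *: "ennreal ?L < (\<integral>\<^sup>+y\<in>cube a l. h i y \<partial>lebesgue) + ennreal (?L / 2)" .
      have "ennreal (1 / 2) * ennreal ?L < (\<integral>\<^sup>+y\<in>cube a l. h i y \<partial>lebesgue)"
      proof (rule ccontr)
        assume "\<not> ?thesis"
        then have "(\<integral>\<^sup>+y\<in>cube a l. h i y \<partial>lebesgue) + ennreal (?L / 2) \<le> ennreal (1 / 2) * ennreal ?L + ennreal (?L / 2)"
          by (intro add_right_mono) simp
        also have "\<dots> = ennreal ?L" unfolding half using l by (subst ennreal_plus[symmetric]) auto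
        finally show False using * by simp
      qed
      then have "ennreal (1 / 2) < average (cube a l) (h i)"
        using l by (subst less_average_cube)
      then show "x \<in> level (ennreal (1 / 2)) (h i)"
        unfolding mem_level using l by blast
    qed
    have wt: "emeasure lebesgue (U i) \<le> ennreal (2 * D) * (\<integral>\<^sup>+y. h i y \<partial>lebesgue)" for i
    proof -
      have "emeasure lebesgue (U i) \<le> emeasure lebesgue (level (ennreal (1 / 2)) (h i))"
        using sub by (intro emeasure_mono) auto
      also have "\<dots> = ennreal 2 * (ennreal (1 / 2) * emeasure lebesgue (level (ennreal (1 / 2)) (h i)))"
        by (subst mult.assoc[symmetric], subst ennreal_mult[symmetric]) auto
      also have "\<dots> \<le> ennreal 2 * (ennreal D * (\<integral>\<^sup>+y. h i y \<partial>lebesgue))"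
        unfolding D_def by (intro mult_left_mono level_weak_type) auto
      also have "\<dots> = ennreal (2 * D) * (\<integral>\<^sup>+y. h i y \<partial>lebesgue)"
        using D by (simp add: ennreal_mult mult.assoc)
      finally show ?thesis .
    qed
    \<comment> \<open>Passing from \<open>g y\<close> to \<open>g y / c\<close> turns the cut
      \<open>c * 2 powr i < g y\<close> into \<open>2 powr i < g y / c\<close>, the form the dyadic
      sum expects; \<open>c \<le> 1\<close> and monotonicity allow the same change inside
      \<open>\<psi>\<close>.\<close>
    have sum: "(\<integral>\<^sup>+i. ennreal (2 powr (real_of_int i * p)) * h i y \<partial>count_space UNIV)
        \<le> ennreal (2 powr (p + 1) * (1 / c) powr p * J) * ennreal (g y powr p)" for y
    proof -
      have "(\<integral>\<^sup>+i. ennreal (2 powr (real_of_int i * p)) * h i y \<partial>count_space UNIV)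
        \<le> (\<integral>\<^sup>+k. ennreal (2 powr (real_of_int k * p) * \<psi> ((g y / c) / 2 powr k)) * indicator {k::int. 2 powr k < g y / c} k \<partial>count_space UNIV)"
      proof (intro nn_integral_mono)
        fix i :: int
        have "\<psi> (g y / 2 powr i) \<le> \<psi> ((g y / c) / 2 powr i)"
          using g[of y] c by (intro mono_onD[OF mono]) (auto intro!: divide_right_mono simp: field_simps mult_left_le_one_le)
        then show "ennreal (2 powr (real_of_int i * p)) * h i y
          \<le> ennreal (2 powr (real_of_int i * p) * \<psi> ((g y / c) / 2 powr i)) * indicator {k::int. 2 powr k < g y / c} i"
          using c nonneg by (auto simp: h_def indicator_def ennreal_mult field_simps intro!: mult_left_mono ennreal_leI)
      qed
      also have "\<dots> \<le> ennreal (2 powr (p + 1) * (g y / c) powr p) * ennreal J"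
        unfolding J(2)[symmetric] using g[of y] c by (intro dyadic_sum_le_integral cont mono nonneg p) auto
      also have "\<dots> = ennreal (2 powr (p + 1) * (1 / c) powr p * J) * ennreal (g y powr p)"
        using g[of y] c J by (simp add: ennreal_mult[symmetric] powr_divide mult_ac)
      finally show ?thesis .
    qed
    have "(\<integral>\<^sup>+x. orlicz_layers p \<psi> g x \<partial>lebesgue)
      = (\<integral>\<^sup>+i. \<integral>\<^sup>+x. ennreal (2 powr (real_of_int i * p)) * indicator (U i) x \<partial>lebesgue \<partial>count_space UNIV)"
      unfolding orlicz_layers_def U_def[symmetric]
      by (intro nn_integral_count_space_nn_integral) (auto simp: U_def)
    also have "\<dots> = (\<integral>\<^sup>+i. ennreal (2 powr (real_of_int i * p)) * emeasure lebesgue (U i) \<partial>count_space UNIV)"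
      by (intro nn_integral_cong nn_integral_cmult_indicator) (auto simp: U_def)
    also have "\<dots> \<le> (\<integral>\<^sup>+i. ennreal (2 powr (real_of_int i * p)) * (ennreal (2 * D) * (\<integral>\<^sup>+y. h i y \<partial>lebesgue)) \<partial>count_space UNIV)"
      by (intro nn_integral_mono mult_left_mono wt) auto
    also have "\<dots> = ennreal (2 * D) * (\<integral>\<^sup>+i. \<integral>\<^sup>+y. ennreal (2 powr (real_of_int i * p)) * h i y \<partial>lebesgue \<partial>count_space UNIV)"
      by (simp add: nn_integral_cmult mult.left_commute)
    also have "\<dots> = ennreal (2 * D) * (\<integral>\<^sup>+y. \<integral>\<^sup>+i. ennreal (2 powr (real_of_int i * p)) * h i y \<partial>count_space UNIV \<partial>lebesgue)"
      by (subst nn_integral_count_space_nn_integral) auto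
    also have "\<dots> \<le> ennreal (2 * D) * (\<integral>\<^sup>+y. ennreal (2 powr (p + 1) * (1 / c) powr p * J) * ennreal (g y powr p) \<partial>lebesgue)"
      by (intro mult_left_mono nn_integral_mono sum) auto
    also have "\<dots> = ennreal (2 * D * (2 powr (p + 1) * (1 / c) powr p * J)) * (\<integral>\<^sup>+y. ennreal (g y powr p) \<partial>lebesgue)"
      using D J c by (subst nn_integral_cmult) (auto simp: ennreal_mult mult.assoc)
    also have "\<dots> \<le> ennreal C * (\<integral>\<^sup>+y. ennreal (g y powr p) \<partial>lebesgue)"
      by (intro mult_right_mono ennreal_leI) (auto simp: C_def)
    finally have "(\<integral>\<^sup>+x. orlicz_layers p \<psi> g x \<partial>lebesgue) \<le> ennreal C * (\<integral>\<^sup>+x. ennreal (g x powr p) \<partial>lebesgue)" .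
  }
  ultimately show ?thesis by blast
qed

subsection \<open>Stopping cubes\<close>

text \<open>Integrability bounds the sides of the cubes through \<open>x\<close> with average above
  \<open>t\<close>, so they have a finite supremum. It need not be attained; an admissible side
  above half of it already excludes all sides of at least \<open>2 * l\<close>.\<close>

lemma level_stopping_cube:
  fixes F :: "real ^ 'n \<Rightarrow> ennreal"
  assumes t: "0 < t" and H: "(\<integral>\<^sup>+y. F y \<partial>lebesgue) \<le> ennreal H" "0 \<le> H"
    and x: "x \<in> level (ennreal t) F"
  shows "\<exists>a l. 0 < l \<and> l \<le> max 1 (H / t) \<and> x \<in> cube a l \<and> ennreal t < average (cube a l) F \<and>
    (\<forall>a' l'. 2 * l \<le> l' \<longrightarrow> x \<in> cube a' l' \<longrightarrow> average (cube a' l') F \<le> ennreal t)"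
proof -
  define S where "S = {l. 0 < l \<and> (\<exists>a. x \<in> cube a l \<and> ennreal t < average (cube a l) F)}"
  have ne: "S \<noteq> {}" using x unfolding mem_level S_def by blast
  have bd: "l \<le> max 1 (H / t)" if "l \<in> S" for l
    using that side_le_if_average_gt[OF t _ _ H] unfolding S_def by blast
  have bdd: "bdd_above S" using bd by (rule bdd_aboveI)
  obtain l0 where "l0 \<in> S" using ne by blast
  then have "0 < l0" "l0 \<le> Sup S" using cSup_upper[OF _ bdd] by (auto simp: S_def)
  then have "Sup S / 2 < Sup S" by simp
  then obtain l where l: "l \<in> S" "Sup S / 2 < l" using less_cSup_iff[OF ne bdd] by blast
  then obtain a where a: "0 < l" "x \<in> cube a l" "ennreal t < average (cube a l) F" by (auto simp: S_def)
  have "average (cube a' l') F \<le> ennreal t" if "2 * l \<le> l'" "x \<in> cube a' l'" for a' l'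
  proof (rule ccontr)
    assume "\<not> average (cube a' l') F \<le> ennreal t"
    then have "l' \<in> S" using that a(1) by (auto simp: S_def)
    then have "l' \<le> Sup S" by (rule cSup_upper[OF _ bdd])
    with that(1) l(2) show False by simp
  qed
  with a bd[OF l(1)] show ?thesis by blast
qed

lemma average_le_cube:
  fixes a :: "real ^ 'n"
  assumes "0 < l" "average (cube a l) h \<le> t"
  shows "(\<integral>\<^sup>+y\<in>cube a l. h y \<partial>lebesgue) \<le> t * ennreal (l ^ CARD('n))"
  using assms by (simp add: average_def emeasure_cube divide_le_ennreal_real)

text \<open>A cube witnessing the higher level at a point of the stopping cube must be shorter than
  the stopping cube, hence lies in the dilate, where cutting off \<open>F\<close> changes nothing.
  The weak type bound can then be charged to the integral of \<open>F\<close> over the dilate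
  alone.\<close>

lemma level_inter_stopping_cube:
  fixes F :: "real ^ 'n \<Rightarrow> ennreal"
  assumes l: "0 < l" and x: "x \<in> cube a l"
    and stop: "\<And>a' l'. 2 * l \<le> l' \<Longrightarrow> x \<in> cube a' l' \<Longrightarrow> average (cube a' l') F \<le> ennreal t"
    and b: "3 ^ CARD('n) \<le> b" and t: "0 < t"
  shows "cube a l \<inter> level (ennreal (b * t)) F \<subseteq> level (ennreal (b * t)) (\<lambda>y. F y * indicator (dilate a l) y)"
proof
  fix y assume y: "y \<in> cube a l \<inter> level (ennreal (b * t)) F"
  then obtain a' l' where R: "0 < l'" "y \<in> cube a' l'" "ennreal (b * t) < average (cube a' l') F"
    unfolding Int_iff mem_level by blast
  have "l' < l"
  proof (rule ccontr)
    assume "\<not> l' < l"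
    \<comment> \<open>The tripled cube reaches \<open>x\<close> because the witness meets the
      stopping cube and is at least as long. Its side exceeds \<open>2 * l\<close>, so its average
      is at most \<open>t\<close>, and that of the witness at most
      \<open>3 ^ CARD('n) * t\<close>.\<close>
    define R' where "R' = cube (a' - vec l') (3 * l')"
    have "x \<in> R'" using \<open>\<not> l' < l\<close> x y R(2) unfolding R'_def mem_cube Int_iff
      by (smt (verit) vec_component vector_minus_component)
    then have "(\<integral>\<^sup>+y\<in>R'. F y \<partial>lebesgue) \<le> ennreal t * ennreal ((3 * l') ^ CARD('n))"
      using \<open>\<not> l' < l\<close> R(1) unfolding R'_def by (intro average_le_cube stop) auto
    moreover have "cube a' l' \<subseteq> R'"
      using R(1) unfolding R'_def
      by (intro subsetI, unfold mem_cube) (smt (verit) vec_component vector_minus_component)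
    then have "(\<integral>\<^sup>+y\<in>cube a' l'. F y \<partial>lebesgue) \<le> (\<integral>\<^sup>+y\<in>R'. F y \<partial>lebesgue)"
      by (intro nn_integral_mono mult_left_mono indicator_leI) auto
    moreover have "ennreal (b * t) * ennreal (l' ^ CARD('n)) < (\<integral>\<^sup>+y\<in>cube a' l'. F y \<partial>lebesgue)"
      using R by (simp add: less_average_cube)
    ultimately have "ennreal (b * t) * ennreal (l' ^ CARD('n)) < ennreal t * ennreal ((3 * l') ^ CARD('n))"
      by (meson less_le_trans)
    moreover have "0 \<le> b" using b by (meson order_trans zero_le_numeral zero_le_power)
    ultimately have "b * t * l' ^ CARD('n) < t * (3 * l') ^ CARD('n)"
      using t R(1) by (simp add: ennreal_mult[symmetric] ennreal_less_iff)
    then have "b < 3 ^ CARD('n)" using t R(1) by (simp add: power_mult_distrib mult.commute)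
    with b show False by simp
  qed
  have ln: "l \<le> real CARD('n) * l" using l by simp
  have "cube a' l' \<subseteq> dilate a l"
  proof
    fix z assume z: "z \<in> cube a' l'"
    have "\<bar>z $ i - a $ i\<bar> \<le> 2 * l" for i
      using z R(2) y \<open>l' < l\<close> unfolding mem_cube Int_iff by (smt (verit))
    moreover have "2 * l \<le> 5 * real CARD('n) * l" using ln l by linarith
    ultimately show "z \<in> dilate a l" unfolding mem_dilate using order_trans by blast
  qed
  then have "average (cube a' l') (\<lambda>y. F y * indicator (dilate a l) y) = average (cube a' l') F"
    unfolding average_def by (intro arg_cong2[where f="(/)"] nn_integral_cong) (auto simp: indicator_def)
  then show "y \<in> level (ennreal (b * t)) (\<lambda>y. F y * indicator (dilate a l) y)"
    unfolding mem_level using R by metis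
qed

text \<open>\<open>key\<close> carries all information relating \<open>u\<close> and
  \<open>N\<close>: it holds at every point \<open>x\<close> of the cube, so it may be integrated
  over any subset. It is applied on the dilate \<open>P\<close> and integrated over the part
  \<open>E\<close> of \<open>Q\<close> outside the higher level. This produces
  \<open>D powr p\<close> (the average over \<open>P\<close> is only known to exceed
  \<open>t / D\<close>), \<open>D\<close> (from \<open>|P| = D * |Q|\<close>) and 2 (from
  \<open>|Q| \<le> 2 * |E|\<close>).\<close>

lemma level_set_estimate:
  fixes F :: "real ^ 'n \<Rightarrow> ennreal" and u N :: "real ^ 'n \<Rightarrow> ennreal" and K p :: real
  defines "D \<equiv> (10 * real CARD('n)) ^ CARD('n)"
  assumes [measurable]: "F \<in> borel_measurable lebesgue" "u \<in> borel_measurable lebesgue" "N \<in> borel_measurable lebesgue"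
    and F: "(\<integral>\<^sup>+y. F y \<partial>lebesgue) < \<infinity>" and K: "0 \<le> K" and p: "0 < p"
    and key: "\<And>a l x s. 0 < l \<Longrightarrow> x \<in> cube a l \<Longrightarrow> 0 \<le> s \<Longrightarrow> ennreal s \<le> average (cube a l) F \<Longrightarrow>
      ennreal (s powr p) * (\<integral>\<^sup>+y\<in>cube a l. u y \<partial>lebesgue) \<le> ennreal K * emeasure lebesgue (cube a l) * N x"
    and t: "0 < t"
  shows "ennreal (t powr p) * (\<integral>\<^sup>+y\<in>level (ennreal t) F. u y \<partial>lebesgue)
    \<le> ennreal (2 * D powr p * D * K) * (\<integral>\<^sup>+y\<in>level (ennreal t) F - level (ennreal (2 * D\<^sup>2 * t)) F. N y \<partial>lebesgue)"
proof -
  have D1: "10 ^ CARD('n) \<le> D" unfolding D_def by (intro power_mono) (auto simp: Suc_leI)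
  have D: "1 \<le> D" using D1 one_le_power[of "10::real" "CARD('n)"] by linarith
  have "3 ^ CARD('n) \<le> (10::real) ^ CARD('n)" by (intro power_mono) auto
  also have "\<dots> \<le> 2 * D\<^sup>2"
    using D1 D mult_left_mono[OF D, of D] unfolding power2_eq_square by linarith
  finally have b3: "3 ^ CARD('n) \<le> 2 * D\<^sup>2" .
  define T where "T = ennreal t"
  define L' where "L' = level (ennreal (2 * D\<^sup>2 * t)) F"
  obtain H where H: "0 \<le> H" "(\<integral>\<^sup>+y. F y \<partial>lebesgue) = ennreal H"
    using F by (cases "\<integral>\<^sup>+y. F y \<partial>lebesgue") auto
  have "\<exists>a l. 0 < l \<and> l \<le> max 1 (H / t) \<and> x \<in> cube a l \<and> T < average (cube a l) F \<and>
    (\<forall>a' l'. 2 * l \<le> l' \<longrightarrow> x \<in> cube a' l' \<longrightarrow> average (cube a' l') F \<le> T)" if "x \<in> level T F" for x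
    using level_stopping_cube[OF t _ H(1), of F x] H(2) that unfolding T_def by simp
  then obtain \<alpha> \<rho> where sel: "\<And>x. x \<in> level T F \<Longrightarrow> 0 < \<rho> x \<and> \<rho> x \<le> max 1 (H / t) \<and> x \<in> cube (\<alpha> x) (\<rho> x) \<and>
      T < average (cube (\<alpha> x) (\<rho> x)) F \<and>
    (\<forall>a' l'. 2 * \<rho> x \<le> l' \<longrightarrow> x \<in> cube a' l' \<longrightarrow> average (cube a' l') F \<le> T)"
    by metis
  have bd: "0 < \<rho> x \<and> \<rho> x \<le> max 1 (H / t)" if "x \<in> level T F" for x using sel[OF that] by blast
  obtain C where C: "countable C" "C \<subseteq> level T F" "disjoint_family_on (\<lambda>i. cube (\<alpha> i) (\<rho> i)) C"
    "(\<Union>i\<in>level T F. cube (\<alpha> i) (\<rho> i)) \<subseteq> (\<Union>i\<in>C. dilate (\<alpha> i) (\<rho> i))"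
    by (rule vitali_cubes[of "level T F" \<rho> "max 1 (H / t)" \<alpha>, OF bd])
  define Q where "Q i = cube (\<alpha> i) (\<rho> i)" for i
  define P where "P i = dilate (\<alpha> i) (\<rho> i)" for i
  define E where "E i = Q i - L'" for i
  have [measurable]: "Q i \<in> sets lebesgue" "P i \<in> sets lebesgue" "L' \<in> sets lebesgue" for i
    by (simp_all add: Q_def P_def L'_def dilate_def)
  have [measurable]: "E i \<in> sets lebesgue" for i by (simp add: E_def)
  have cov: "level T F \<subseteq> (\<Union>i\<in>C. P i)"
  proof
    fix x assume "x \<in> level T F"
    then have "x \<in> (\<Union>i\<in>level T F. cube (\<alpha> i) (\<rho> i))" using sel by blast
    then show "x \<in> (\<Union>i\<in>C. P i)" unfolding P_def using C(4) by (rule rev_subsetD)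
  qed
  have main: "ennreal (t powr p) * (\<integral>\<^sup>+y\<in>P i. u y \<partial>lebesgue) \<le> ennreal (2 * D powr p * D * K) * (\<integral>\<^sup>+y\<in>E i. N y \<partial>lebesgue)"
    if "i \<in> C" for i
  proof -
    define l where "l = \<rho> i"
    define a where "a = \<alpha> i"
    from that C(2) have i: "i \<in> level T F" by blast
    have l: "0 < l" and iQ: "i \<in> cube a l" and av: "T < average (cube a l) F"
      and stop: "\<And>a' l'. 2 * l \<le> l' \<Longrightarrow> i \<in> cube a' l' \<Longrightarrow> average (cube a' l') F \<le> T"
      using sel[OF i] by (auto simp: l_def a_def)
    define V where "V = l ^ CARD('n)"
    have V: "0 < V" using l by (simp add: V_def)
    have mQ: "emeasure lebesgue (Q i) = ennreal V" using l by (simp add: Q_def V_def l_def emeasure_cube)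
    have mP: "emeasure lebesgue (P i) = ennreal (D * V)"
      using l D by (simp add: P_def V_def l_def emeasure_dilate emeasure_cube D_def ennreal_mult)
    have QP: "Q i \<subseteq> P i" using l by (simp add: Q_def P_def l_def cube_subset_dilate)
    define a2 where "a2 = a - vec (5 * real CARD('n) * l)"
    define l2 where "l2 = 10 * real CARD('n) * l"
    have P: "P i = cube a2 l2" by (simp add: P_def dilate_def a2_def l2_def a_def l_def)
    have l2: "0 < l2" "2 * l \<le> l2" "l2 ^ CARD('n) = D * V"
    proof -
      show "0 < l2" using l by (simp add: l2_def)
      have "l \<le> real CARD('n) * l" using l by simp
      then show "2 * l \<le> l2" using l unfolding l2_def by linarith
      show "l2 ^ CARD('n) = D * V" by (simp add: l2_def D_def V_def power_mult_distrib)
    qed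
    \<comment> \<open>\<open>P\<close> is a cube through the stopping point \<open>i\<close> with
      side at least \<open>2 * l\<close>, so the stopping rule bounds its average by
      \<open>t\<close>.\<close>
    have avP: "(\<integral>\<^sup>+y\<in>P i. F y \<partial>lebesgue) \<le> ennreal (t * (D * V))"
    proof -
      have "i \<in> cube a2 l2" using QP iQ unfolding P Q_def a_def l_def by blast
      then have "(\<integral>\<^sup>+y\<in>P i. F y \<partial>lebesgue) \<le> T * ennreal (l2 ^ CARD('n))"
        unfolding P using l2 by (intro average_le_cube stop)
      then show ?thesis unfolding l2 T_def using t D V by (simp add: ennreal_mult)
    qed
    \<comment> \<open>The lower bound comes from the selection: the average over \<open>Q\<close>
      exceeds \<open>t\<close>, and enlarging \<open>Q\<close> to \<open>P\<close> divides it by at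
      most \<open>D\<close>.\<close>
    have avP2: "ennreal (t / D) \<le> average (cube a2 l2) F"
    proof -
      have "ennreal (t / D) * ennreal (D * V) = ennreal (t * V)"
        using t D V by (subst ennreal_mult[symmetric]) auto
      also have "\<dots> = T * ennreal V" unfolding T_def using t V by (subst ennreal_mult[symmetric]) auto
      also have "\<dots> < (\<integral>\<^sup>+y\<in>Q i. F y \<partial>lebesgue)"
        using av l by (simp add: less_average_cube Q_def V_def a_def l_def)
      also have "\<dots> \<le> (\<integral>\<^sup>+y\<in>P i. F y \<partial>lebesgue)"
        using QP by (intro nn_integral_mono mult_left_mono indicator_leI) auto
      finally have "ennreal (t / D) < average (cube a2 l2) F"
        using l2 by (simp add: less_average_cube P)
      then show ?thesis by simp
    qed
    \<comment> \<open>The weak type bound for \<open>F\<close> cut off to \<open>P\<close> gives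
      \<open>2 * D\<^sup>2 * t * |Q \<inter> L'| \<le> D * (t * (D * V))\<close>; the factor
      \<open>2 * D\<^sup>2\<close> in \<open>L'\<close> makes the resulting bound
      \<open>V / 2\<close>.\<close>
    have QL: "emeasure lebesgue (Q i \<inter> L') \<le> ennreal (V / 2)"
    proof -
      define G where "G y = F y * indicator (P i) y" for y
      have [measurable]: "G \<in> borel_measurable lebesgue" unfolding G_def by measurable
      have "Q i \<inter> L' \<subseteq> level (ennreal (2 * D\<^sup>2 * t)) G"
        using level_inter_stopping_cube[OF l iQ stop[unfolded T_def] b3 t]
        unfolding Q_def L'_def G_def P_def a_def l_def by simp
      then have "emeasure lebesgue (Q i \<inter> L') \<le> emeasure lebesgue (level (ennreal (2 * D\<^sup>2 * t)) G)"
        by (intro emeasure_mono) auto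
      then have "ennreal (2 * D\<^sup>2 * t) * emeasure lebesgue (Q i \<inter> L')
          \<le> ennreal (2 * D\<^sup>2 * t) * emeasure lebesgue (level (ennreal (2 * D\<^sup>2 * t)) G)"
        by (intro mult_left_mono) auto
      also have "\<dots> \<le> ennreal D * (\<integral>\<^sup>+y. G y \<partial>lebesgue)"
        unfolding D_def using t by (intro level_weak_type) auto
      also have "\<dots> \<le> ennreal D * ennreal (t * (D * V))"
        unfolding G_def by (intro mult_left_mono avP) simp
      finally have *: "ennreal (2 * D\<^sup>2 * t) * emeasure lebesgue (Q i \<inter> L') \<le> ennreal (D\<^sup>2 * t * V)"
        using D t V by (simp add: ennreal_mult[symmetric] power2_eq_square mult_ac)
      have "emeasure lebesgue (Q i \<inter> L') \<le> emeasure lebesgue (Q i)" by (intro emeasure_mono) auto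
      then obtain m where m: "0 \<le> m" "emeasure lebesgue (Q i \<inter> L') = ennreal m"
        unfolding mQ by (cases "emeasure lebesgue (Q i \<inter> L')") (auto simp: top_unique)
      have "2 * D\<^sup>2 * t * m \<le> D\<^sup>2 * t * V"
        using * m t D V by (simp add: ennreal_mult[symmetric])
      then have "(D\<^sup>2 * t) * (2 * m) \<le> (D\<^sup>2 * t) * V" by simp
      then have "2 * m \<le> V" using D t by (simp add: mult_le_cancel_left)
      then show ?thesis using m by (simp add: ennreal_leI)
    qed
    obtain e where e: "emeasure lebesgue (E i) = ennreal e" "V / 2 \<le> e"
    proof -
      have "emeasure lebesgue (E i) \<le> emeasure lebesgue (Q i)" by (intro emeasure_mono) (auto simp: E_def)
      then obtain e where e: "0 \<le> e" "emeasure lebesgue (E i) = ennreal e"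
        unfolding mQ by (cases "emeasure lebesgue (E i)") (auto simp: top_unique)
      have "ennreal V = emeasure lebesgue (E i) + emeasure lebesgue (Q i \<inter> L')"
        unfolding mQ[symmetric] E_def by (subst plus_emeasure) (auto intro!: arg_cong[where f="emeasure lebesgue"])
      also have "\<dots> \<le> ennreal e + ennreal (V / 2)" using e QL by (simp add: add_left_mono)
      also have "\<dots> = ennreal (e + V / 2)" using e V by simp
      finally have "V \<le> e + V / 2" using e V by (simp del: ennreal_plus)
      then show thesis using e by (intro that[of e]) auto
    qed
    have e0: "0 < e" using e V by simp
    define U where "U = ennreal (t powr p) * (\<integral>\<^sup>+y\<in>P i. u y \<partial>lebesgue)"
    have U: "U \<le> ennreal (D powr p * K * (D * V)) * N x" if "x \<in> P i" for x
    proof -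
      have "ennreal ((t / D) powr p) * (\<integral>\<^sup>+y\<in>P i. u y \<partial>lebesgue) \<le> ennreal K * ennreal (D * V) * N x"
        using key[OF l2(1) that[unfolded P] _ avP2] t D unfolding P mP[unfolded P] by auto
      then have "ennreal (D powr p) * (ennreal ((t / D) powr p) * (\<integral>\<^sup>+y\<in>P i. u y \<partial>lebesgue))
          \<le> ennreal (D powr p) * (ennreal K * ennreal (D * V) * N x)"
        by (rule mult_left_mono) simp
      moreover have "ennreal (D powr p) * (ennreal ((t / D) powr p) * (\<integral>\<^sup>+y\<in>P i. u y \<partial>lebesgue)) = U"
        unfolding U_def using t D by (simp add: mult.assoc[symmetric] ennreal_mult[symmetric] powr_divide)
      moreover have "ennreal (D powr p) * (ennreal K * ennreal (D * V) * N x) = ennreal (D powr p * K * (D * V)) * N x"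
        using K D V by (simp add: ennreal_mult mult_ac)
      ultimately show ?thesis by simp
    qed
    \<comment> \<open>\<open>U\<close> is a constant bounded by a multiple of \<open>N\<close> at
      every point of \<open>E i\<close>, so integrating over \<open>E i\<close> produces the factor
      \<open>e\<close>; it can be cancelled at the end because it is positive and finite.\<close>
    have "U * ennreal e = (\<integral>\<^sup>+y\<in>E i. U \<partial>lebesgue)"
      by (subst nn_integral_cmult_indicator) (auto simp: e)
    also have "\<dots> \<le> (\<integral>\<^sup>+y. ennreal (D powr p * K * (D * V)) * (N y * indicator (E i) y) \<partial>lebesgue)"
      using U QP by (intro nn_integral_mono) (auto simp: indicator_def E_def)
    also have "\<dots> = ennreal (D powr p * K * (D * V)) * (\<integral>\<^sup>+y\<in>E i. N y \<partial>lebesgue)"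
      by (intro nn_integral_cmult) auto
    also have "\<dots> \<le> ennreal (2 * D powr p * D * K * e) * (\<integral>\<^sup>+y\<in>E i. N y \<partial>lebesgue)"
    proof (intro mult_right_mono ennreal_leI)
      have "(D powr p * K * D) * V \<le> (D powr p * K * D) * (2 * e)"
        using e K D by (intro mult_left_mono) auto
      then show "D powr p * K * (D * V) \<le> 2 * D powr p * D * K * e" by (simp add: mult_ac)
    qed simp
    also have "\<dots> = ennreal (2 * D powr p * D * K) * (\<integral>\<^sup>+y\<in>E i. N y \<partial>lebesgue) * ennreal e"
      using e0 D K by (simp add: ennreal_mult mult_ac)
    finally have "ennreal e * U \<le> ennreal e * (ennreal (2 * D powr p * D * K) * (\<integral>\<^sup>+y\<in>E i. N y \<partial>lebesgue))"
      by (simp add: mult_ac)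
    then show ?thesis
      unfolding U_def[symmetric] using e0 by (subst (asm) ennreal_mult_le_mult_iff) auto
  qed
  have "(\<integral>\<^sup>+y\<in>level T F. u y \<partial>lebesgue) \<le> (\<integral>\<^sup>+y\<in>(\<Union>i\<in>C. P i). u y \<partial>lebesgue)"
    using cov by (intro nn_integral_mono mult_left_mono indicator_leI) auto
  also have "\<dots> = emeasure (density lebesgue u) (\<Union>i\<in>C. P i)"
    using C(1) by (intro emeasure_density[symmetric]) auto
  also have "\<dots> \<le> (\<integral>\<^sup>+i. emeasure (density lebesgue u) (P i) \<partial>count_space C)"
    using C(1) by (intro emeasure_UN_le_nn_integral) auto
  also have "\<dots> = (\<integral>\<^sup>+i. (\<integral>\<^sup>+y\<in>P i. u y \<partial>lebesgue) \<partial>count_space C)"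
    by (intro nn_integral_cong emeasure_density) auto
  finally have "ennreal (t powr p) * (\<integral>\<^sup>+y\<in>level T F. u y \<partial>lebesgue)
      \<le> ennreal (t powr p) * (\<integral>\<^sup>+i. (\<integral>\<^sup>+y\<in>P i. u y \<partial>lebesgue) \<partial>count_space C)"
    by (rule mult_left_mono) simp
  also have "\<dots> = (\<integral>\<^sup>+i. ennreal (t powr p) * (\<integral>\<^sup>+y\<in>P i. u y \<partial>lebesgue) \<partial>count_space C)"
    by (simp add: nn_integral_cmult)
  also have "\<dots> \<le> (\<integral>\<^sup>+i. ennreal (2 * D powr p * D * K) * (\<integral>\<^sup>+y\<in>E i. N y \<partial>lebesgue) \<partial>count_space C)"
    by (intro nn_integral_mono main) simp
  also have "\<dots> = ennreal (2 * D powr p * D * K) * (\<integral>\<^sup>+i. (\<integral>\<^sup>+y\<in>E i. N y \<partial>lebesgue) \<partial>count_space C)"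
    by (simp add: nn_integral_cmult)
  also have "\<dots> \<le> ennreal (2 * D powr p * D * K) * (\<integral>\<^sup>+y\<in>level T F - L'. N y \<partial>lebesgue)"
  proof (intro mult_left_mono nn_integral_disjoint_UN_le)
    show "disjoint_family_on E C"
      using C(3) unfolding disjoint_family_on_def E_def Q_def by blast
    fix i assume "i \<in> C"
    then have "T < average (Q i) F" "Q i \<in> cubes"
      using C(2) sel unfolding Q_def by (auto intro!: cube_in_cubes)
    then show "E i \<subseteq> level T F - L'" unfolding E_def level_def by blast
  qed (use C in auto)
  finally show ?thesis unfolding T_def L'_def .
qed

text \<open>The ratio \<open>b\<close> equals the factor \<open>2 * D\<^sup>2\<close> that separates
  the two levels in the one-level estimate, so the set removed at height \<open>b powr k\<close> is
  exactly the level set at \<open>b powr (k + 1)\<close>. The differences are then disjoint, and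
  summing over \<open>k\<close> costs no further constant.\<close>

lemma level_sum_estimate:
  fixes F :: "real ^ 'n \<Rightarrow> ennreal" and u N :: "real ^ 'n \<Rightarrow> ennreal" and K p :: real
  defines "D \<equiv> (10 * real CARD('n)) ^ CARD('n)"
  defines "b \<equiv> 2 * D\<^sup>2"
  assumes [measurable]: "F \<in> borel_measurable lebesgue" "u \<in> borel_measurable lebesgue" "N \<in> borel_measurable lebesgue"
    and F: "(\<integral>\<^sup>+y. F y \<partial>lebesgue) < \<infinity>" and K: "0 \<le> K" and p: "0 < p"
    and key: "\<And>a l x s. 0 < l \<Longrightarrow> x \<in> cube a l \<Longrightarrow> 0 \<le> s \<Longrightarrow> ennreal s \<le> average (cube a l) F \<Longrightarrow>
      ennreal (s powr p) * (\<integral>\<^sup>+y\<in>cube a l. u y \<partial>lebesgue) \<le> ennreal K * emeasure lebesgue (cube a l) * N x"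
  shows "(\<integral>\<^sup>+k. ennreal (b powr (real_of_int k * p)) *
      (\<integral>\<^sup>+y\<in>level (ennreal (b powr k)) F. u y \<partial>lebesgue) \<partial>count_space UNIV)
    \<le> ennreal (2 * D powr p * D * K) * (\<integral>\<^sup>+y. N y \<partial>lebesgue)"
proof -
  have "1 \<le> real CARD('n)" by (simp add: Suc_leI)
  then have "1 \<le> 10 * real CARD('n)" by linarith
  then have D: "1 \<le> D" unfolding D_def by (rule one_le_power)
  then have b: "1 < b" unfolding b_def using one_le_power[of D 2] by linarith
  define L where "L k = level (ennreal (b powr real_of_int k)) F" for k
  have [measurable]: "L k \<in> sets lebesgue" for k by (simp add: L_def)
  have Ldec: "L k \<subseteq> L j" if "j \<le> k" for j k
    unfolding L_def using b that by (intro level_mono ennreal_leI powr_mono) auto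
  have disj: "disjoint_family_on (\<lambda>k. L k - L (k + 1)) UNIV"
    unfolding disjoint_family_on_def
  proof (intro ballI impI)
    have *: "(L j - L (j + 1)) \<inter> (L k - L (k + 1)) = {}" if "j < k" for j k
      using Ldec[of "j + 1" k] that by auto
    fix j k :: int assume "j \<noteq> k"
    then show "(L j - L (j + 1)) \<inter> (L k - L (k + 1)) = {}"
      using *[of j k] *[of k j] by (cases "j < k") (simp_all add: Int_commute)
  qed
  have "(\<integral>\<^sup>+k. ennreal (b powr (real_of_int k * p)) * (\<integral>\<^sup>+y\<in>L k. u y \<partial>lebesgue) \<partial>count_space UNIV)
    \<le> (\<integral>\<^sup>+k. ennreal (2 * D powr p * D * K) * (\<integral>\<^sup>+y\<in>L k - L (k + 1). N y \<partial>lebesgue) \<partial>count_space UNIV)"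
  proof (intro nn_integral_mono)
    fix k :: int
    have "ennreal ((b powr k) powr p) * (\<integral>\<^sup>+y\<in>level (ennreal (b powr k)) F. u y \<partial>lebesgue)
      \<le> ennreal (2 * D powr p * D * K) *
        (\<integral>\<^sup>+y\<in>level (ennreal (b powr k)) F - level (ennreal (2 * D\<^sup>2 * b powr k)) F. N y \<partial>lebesgue)"
      unfolding D_def by (rule level_set_estimate) (use F K p key b in auto)
    moreover have "2 * D\<^sup>2 * b powr k = b powr (k + 1)" using b by (simp add: powr_add b_def)
    ultimately show "ennreal (b powr (real_of_int k * p)) * (\<integral>\<^sup>+y\<in>L k. u y \<partial>lebesgue)
      \<le> ennreal (2 * D powr p * D * K) * (\<integral>\<^sup>+y\<in>L k - L (k + 1). N y \<partial>lebesgue)"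
      using b by (simp add: L_def powr_powr)
  qed
  also have "\<dots> = ennreal (2 * D powr p * D * K) * (\<integral>\<^sup>+k. (\<integral>\<^sup>+y\<in>L k - L (k + 1). N y \<partial>lebesgue) \<partial>count_space UNIV)"
    by (simp add: nn_integral_cmult)
  also have "\<dots> \<le> ennreal (2 * D powr p * D * K) * (\<integral>\<^sup>+y\<in>UNIV. N y \<partial>lebesgue)"
    using disj by (intro mult_left_mono nn_integral_disjoint_UN_le) auto
  finally show ?thesis by (simp add: L_def)
qed

text \<open>Membership on the left is a strict inequality for the integral over one cube; monotone
  convergence on that cube passes it to some \<open>F j\<close>.\<close>

lemma level_SUP:
  fixes F :: "nat \<Rightarrow> real ^ 'n \<Rightarrow> ennreal"
  assumes [measurable]: "\<And>j. F j \<in> borel_measurable lebesgue" and inc: "incseq F"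
  shows "level t (\<lambda>y. SUP j. F j y) = (\<Union>j. level t (F j))"
proof
  show "(\<Union>j. level t (F j)) \<subseteq> level t (\<lambda>y. SUP j. F j y)"
    by (intro UN_least level_mono SUP_upper) auto
  show "level t (\<lambda>y. SUP j. F j y) \<subseteq> (\<Union>j. level t (F j))"
  proof
    fix x assume "x \<in> level t (\<lambda>y. SUP j. F j y)"
    then obtain a l where l: "0 < l" "x \<in> cube a l" "t < average (cube a l) (\<lambda>y. SUP j. F j y)"
      unfolding mem_level by blast
    have "(\<integral>\<^sup>+y\<in>cube a l. (SUP j. F j y) \<partial>lebesgue) = (\<integral>\<^sup>+y. (SUP j. F j y * indicator (cube a l) y) \<partial>lebesgue)"
      by (simp add: SUP_mult_right_ennreal)
    also have "\<dots> = (SUP j. \<integral>\<^sup>+y\<in>cube a l. F j y \<partial>lebesgue)"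
      using inc by (intro nn_integral_monotone_convergence_SUP) (auto simp: incseq_def le_fun_def intro!: mult_right_mono)
    finally obtain j where "t * ennreal (l ^ CARD('n)) < (\<integral>\<^sup>+y\<in>cube a l. F j y \<partial>lebesgue)"
      using l by (auto simp: less_average_cube less_SUP_iff)
    then have "t < average (cube a l) (F j)" using l(1) by (simp add: less_average_cube)
    with l show "x \<in> (\<Union>j. level t (F j))" by (auto simp: mem_level)
  qed
qed

lemma less_maximal_iff: "t < maximal f x \<longleftrightarrow> x \<in> level t (\<lambda>y. ennreal \<bar>f y\<bar>)"
  by (auto simp: maximal_def level_def less_SUP_iff)

subsection \<open>Weights and the bump condition\<close>

text \<open>Local integrability gives measurability on each ball, and \<open>w\<close> is the
  pointwise limit of its restrictions to balls about 0.\<close>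

lemma weight_borel_measurable:
  fixes w :: "real ^ 'n \<Rightarrow> real"
  assumes "weight w" shows "w \<in> borel_measurable lebesgue"
proof (rule borel_measurable_LIMSEQ_real)
  fix x :: "real ^ 'n"
  have "\<forall>\<^sub>F j in sequentially. indicator (cball 0 (real j)) x *\<^sub>R w x = w x"
    using eventually_ge_at_top[of "nat \<lceil>norm x\<rceil>"]
    by eventually_elim (auto simp: indicator_def nat_le_iff ceiling_le_iff)
  then show "(\<lambda>j. indicator (cball 0 (real j)) x *\<^sub>R w x) \<longlonglongrightarrow> w x"
    by (rule tendsto_eventually)
next
  fix j
  have "set_integrable lebesgue (cball 0 (real j)) w" using assms by (simp add: weight_def)
  then show "(\<lambda>x. indicator (cball 0 (real j)) x *\<^sub>R w x) \<in> borel_measurable lebesgue"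
    unfolding set_integrable_def by (rule borel_measurable_integrable)
qed

text \<open>The substitution bound, applied to the indicator of the null set where \<open>w\<close>
  is not positive, shows that its preimage under \<open>A\<close> is null as well.\<close>

lemma weight_linear_pos_AE:
  fixes A :: "real ^ 'n ^ 'n"
  assumes A: "invertible A" and w: "weight w"
  shows "AE x in lebesgue. 0 < w (A *v x)"
proof -
  note [measurable] = measurable_matrix_vector_mult_lebesgue[OF A] weight_borel_measurable[OF w]
  obtain C :: real where C: "0 < C" "\<And>h. h \<in> borel_measurable lebesgue \<Longrightarrow>
      (\<integral>\<^sup>+x. h (A *v x) \<partial>lebesgue) \<le> ennreal C * (\<integral>\<^sup>+x. h x \<partial>lebesgue)"
    using nn_integral_linear_le(2)[OF A] by blast
  define h :: "real ^ 'n \<Rightarrow> ennreal" where "h = indicator {x. \<not> 0 < w x}"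
  have [measurable]: "h \<in> borel_measurable lebesgue" unfolding h_def by measurable
  have "AE x in lebesgue. h x = 0" using w by (auto simp: weight_def h_def)
  then have "(\<integral>\<^sup>+x. h x \<partial>lebesgue) = 0" by (subst nn_integral_0_iff_AE) auto
  then have "(\<integral>\<^sup>+x. h (A *v x) \<partial>lebesgue) = 0" using C(2)[of h] by simp
  then have "AE x in lebesgue. h (A *v x) = 0" by (subst (asm) nn_integral_0_iff_AE) auto
  then show ?thesis by eventually_elim (auto simp: h_def indicator_def split: if_splits)
qed

text \<open>The image of the cube under \<open>A\<close> is compact, so local integrability of
  \<open>w\<close> applies there, and the substitution bound carries it back to the cube.\<close>

lemma weight_linear_cube_finite:
  fixes A :: "real ^ 'n ^ 'n"
  assumes A: "invertible A" and w: "weight w"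
  shows "(\<integral>\<^sup>+y\<in>cube a l. ennreal (w (A *v y)) \<partial>lebesgue) < \<infinity>"
proof -
  note [measurable] = weight_borel_measurable[OF w]
  obtain C :: real where C: "0 < C" "\<And>h. h \<in> borel_measurable lebesgue \<Longrightarrow>
      (\<integral>\<^sup>+x. h (A *v x) \<partial>lebesgue) \<le> ennreal C * (\<integral>\<^sup>+x. h x \<partial>lebesgue)"
    using nn_integral_linear_le(2)[OF A] by blast
  define M where "M = (*v) A ` cube a l"
  have M: "compact M"
    unfolding M_def cube_def by (intro compact_continuous_image linear_continuous_on) (auto simp: linear_linear)
  then have [measurable]: "M \<in> sets lebesgue" by (simp add: compact_imp_closed)
  have "inj ((*v) A)" using invertible_matrix_vector_inv(1)[OF A] by (metis injI)
  then have ind: "indicator (cube a l) y = (indicator M (A *v y) :: ennreal)" for y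
    unfolding M_def by (auto simp: indicator_def inj_image_mem_iff)
  have le: "(\<integral>\<^sup>+y\<in>cube a l. ennreal (w (A *v y)) \<partial>lebesgue) \<le> ennreal C * (\<integral>\<^sup>+y\<in>M. ennreal (w y) \<partial>lebesgue)"
    unfolding ind by (rule C(2)) measurable
  have "(\<integral>\<^sup>+y\<in>M. ennreal (w y) \<partial>lebesgue) \<le> (\<integral>\<^sup>+y. ennreal (norm (indicator M y *\<^sub>R w y)) \<partial>lebesgue)"
    by (intro nn_integral_mono) (auto simp: indicator_def intro!: ennreal_leI)
  also have "\<dots> < \<infinity>"
    using w M unfolding weight_def set_integrable_def by (auto simp: integrable_iff_bounded)
  finally show ?thesis by (intro le_less_trans[OF le]) (simp add: ennreal_mult_less_top)
qed

text \<open>Raising the constant by 1 puts the Luxemburg infimum strictly below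
  \<open>(K0 + 1) / r\<close>, so an admissible scale \<open>c\<close> can be picked there whether
  or not the infimum is attained. Taking \<open>c * r \<le> K0 + 1\<close> to the power
  \<open>p\<close> gives the bound.\<close>

lemma A_class_cube_bound:
  fixes A :: "real ^ 'n ^ 'n"
  assumes A: "invertible A" and p: "0 < p" and w: "w \<in> A_class A p \<phi>"
  obtains K where "0 < K"
    "\<And>a l. 0 < l \<Longrightarrow> (\<integral>\<^sup>+y\<in>cube a l. ennreal (w (A *v y)) \<partial>lebesgue) \<noteq> 0 \<Longrightarrow>
      \<exists>c>0. average (cube a l) (\<lambda>y. ennreal (\<phi> (\<bar>w y powr (- 1 / p)\<bar> / c))) \<le> 1 \<and>
        ennreal (c powr p) * (\<integral>\<^sup>+y\<in>cube a l. ennreal (w (A *v y)) \<partial>lebesgue)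
          \<le> ennreal (K powr p) * emeasure lebesgue (cube a l)"
proof -
  have wt: "weight w" and fin: "A_const A p \<phi> w < \<infinity>" using w by (auto simp: A_class_def)
  obtain K0 where K0: "0 \<le> K0" "A_const A p \<phi> w = ennreal K0" using fin by (cases "A_const A p \<phi> w") auto
  show thesis
  proof (rule that[of "K0 + 1"])
    fix a :: "real ^ 'n" and l :: real
    assume l: "0 < l"
    define Q where "Q = cube a l"
    assume "(\<integral>\<^sup>+y\<in>cube a l. ennreal (w (A *v y)) \<partial>lebesgue) \<noteq> 0"
    then obtain V where V: "0 < V" "(\<integral>\<^sup>+y\<in>Q. ennreal (w (A *v y)) \<partial>lebesgue) = ennreal V"
      using weight_linear_cube_finite[OF A wt, of a l] unfolding Q_def
      by (cases "\<integral>\<^sup>+y\<in>cube a l. ennreal (w (A *v y)) \<partial>lebesgue") (auto simp: less_le)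
    define m where "m = l ^ CARD('n)"
    have m: "0 < m" "emeasure lebesgue Q = ennreal m" using l by (auto simp: m_def Q_def emeasure_cube)
    have "(\<integral>\<^sup>+y\<in>Q. ennreal (\<bar>w (A *v y) powr (1 / p)\<bar> powr p) \<partial>lebesgue) = (\<integral>\<^sup>+y\<in>Q. ennreal (w (A *v y)) \<partial>lebesgue)"
      using weight_linear_pos_AE[OF A wt]
      by (intro nn_integral_cong_AE, eventually_elim) (use p in \<open>simp add: powr_powr\<close>)
    then have L: "Lp_average p Q (\<lambda>x. w (A *v x) powr (1 / p)) = ennreal ((V / m) powr (1 / p))"
      using V m by (simp add: Lp_average_def average_def divide_ennreal epowr_def)
    define r where "r = (V / m) powr (1 / p)"
    have r: "0 < r" "r powr p = V / m" using V m p by (auto simp: r_def powr_powr)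
    have "Lp_average p Q (\<lambda>x. w (A *v x) powr (1 / p)) * luxemburg \<phi> Q (\<lambda>x. w x powr (- 1 / p)) \<le> ennreal K0"
      unfolding K0(2)[symmetric] A_const_def Q_def using cube_in_cubes[OF l, of a] by (rule SUP_upper)
    then have "ennreal r * luxemburg \<phi> Q (\<lambda>x. w x powr (- 1 / p)) \<le> ennreal K0" unfolding L r_def .
    also have "\<dots> < ennreal r * ennreal ((K0 + 1) / r)"
      using r K0 by (simp add: ennreal_mult[symmetric] ennreal_less_iff)
    finally have "luxemburg \<phi> Q (\<lambda>x. w x powr (- 1 / p)) < ennreal ((K0 + 1) / r)"
      by (meson mult_left_mono not_le zero_le)
    then obtain c where c: "0 < c" "average Q (\<lambda>y. ennreal (\<phi> (\<bar>w y powr (- 1 / p)\<bar> / c))) \<le> 1"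
      "ennreal c < ennreal ((K0 + 1) / r)"
      unfolding luxemburg_def INF_less_iff by blast
    from c(1,3) have "c * r \<le> K0 + 1" using r K0 by (simp add: ennreal_less_iff field_simps)
    then have "(c * r) powr p \<le> (K0 + 1) powr p" using c r p by (intro powr_mono2) auto
    then have "c powr p * V \<le> (K0 + 1) powr p * m"
      using c r m by (simp add: powr_mult field_simps)
    then have "ennreal (c powr p) * (\<integral>\<^sup>+y\<in>Q. ennreal (w (A *v y)) \<partial>lebesgue)
          \<le> ennreal ((K0 + 1) powr p) * emeasure lebesgue Q"
      unfolding V(2) m(2) using V m by (simp add: ennreal_mult[symmetric])
    with c show "\<exists>c>0. average (cube a l) (\<lambda>y. ennreal (\<phi> (\<bar>w y powr (- 1 / p)\<bar> / c))) \<le> 1 \<and>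
        ennreal (c powr p) * (\<integral>\<^sup>+y\<in>cube a l. ennreal (w (A *v y)) \<partial>lebesgue)
          \<le> ennreal ((K0 + 1) powr p) * emeasure lebesgue (cube a l)"
      unfolding Q_def by blast
  qed (use K0 in simp)
qed

section \<open>Young's inequality and generalized Hoelder on cubes\<close>

lemma young_inequality:
  assumes "complementary \<phi> t < \<infinity>" "0 \<le> s"
  shows "s * t \<le> \<phi> s + enn2real (complementary \<phi> t)"
proof -
  have "ennreal (s * t - \<phi> s) \<le> complementary \<phi> t"
    unfolding complementary_def using assms(2) by (intro SUP_upper) auto
  also have "\<dots> = ennreal (enn2real (complementary \<phi> t))" using assms(1) by simp
  finally show ?thesis by (simp add: ennreal_le_iff)
qed

text \<open>Young's inequality for \<open>h y / c\<close> and \<open>g y / d\<close> is multiplied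
  by \<open>c * d\<close> and averaged; each of the two averages is at most 1, whence the factor 2.
  The bound on \<open>F\<close> is asked for almost everywhere because in the application
  \<open>g * h\<close> recovers \<open>|f|\<close> where the weight is positive.\<close>

lemma average_le_young:
  fixes \<phi> \<psi> :: "real \<Rightarrow> real" and g h :: "real ^ 'n \<Rightarrow> real"
  assumes young: "\<And>s t. 0 \<le> s \<Longrightarrow> 0 \<le> t \<Longrightarrow> s * t \<le> \<phi> s + \<psi> t"
    and nonneg: "\<And>s. 0 \<le> s \<Longrightarrow> 0 \<le> \<phi> s" "\<And>s. 0 \<le> \<psi> s"
    and meas: "(\<lambda>y. ennreal (\<phi> (h y / c))) \<in> borel_measurable lebesgue" "(\<lambda>y. ennreal (\<psi> (g y / d))) \<in> borel_measurable lebesgue"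
    and gh: "\<And>y. 0 \<le> g y" "\<And>y. 0 \<le> h y" and c: "0 < c" and d: "0 < d" and l: "0 < l"
    and avh: "average (cube a l) (\<lambda>y. ennreal (\<phi> (h y / c))) \<le> 1"
    and avg: "average (cube a l) (\<lambda>y. ennreal (\<psi> (g y / d))) \<le> 1"
    and F: "AE y in lebesgue. F y \<le> ennreal (g y * h y)"
  shows "average (cube a l) F \<le> ennreal (2 * c * d)"
proof -
  note [measurable] = meas
  define m where "m = l ^ CARD('n)"
  have m: "0 < m" using l by (simp add: m_def)
  have bd: "(\<integral>\<^sup>+y\<in>cube a l. ennreal (\<phi> (h y / c)) \<partial>lebesgue) \<le> ennreal m"
    "(\<integral>\<^sup>+y\<in>cube a l. ennreal (\<psi> (g y / d)) \<partial>lebesgue) \<le> ennreal m"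
    using average_le_cube[OF l avh] average_le_cube[OF l avg] by (simp_all add: m_def)
  have "(\<integral>\<^sup>+y\<in>cube a l. F y \<partial>lebesgue)
    \<le> (\<integral>\<^sup>+y. ennreal (c * d) * (ennreal (\<phi> (h y / c)) * indicator (cube a l) y + ennreal (\<psi> (g y / d)) * indicator (cube a l) y) \<partial>lebesgue)"
  proof (intro nn_integral_mono_AE)
    show "AE y in lebesgue. F y * indicator (cube a l) y \<le>
      ennreal (c * d) * (ennreal (\<phi> (h y / c)) * indicator (cube a l) y + ennreal (\<psi> (g y / d)) * indicator (cube a l) y)"
      using F
    proof eventually_elim
      case (elim y)
      have "(h y / c) * (g y / d) \<le> \<phi> (h y / c) + \<psi> (g y / d)" using gh c d by (intro young) auto
      then have "g y * h y \<le> c * d * (\<phi> (h y / c) + \<psi> (g y / d))" using c d by (simp add: field_simps)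
      then have "F y \<le> ennreal (c * d * (\<phi> (h y / c) + \<psi> (g y / d)))" using elim by (meson ennreal_leI order_trans)
      also have "\<dots> = ennreal (c * d) * (ennreal (\<phi> (h y / c)) + ennreal (\<psi> (g y / d)))"
        using c d gh nonneg by (subst ennreal_plus[symmetric], simp, simp, subst ennreal_mult[symmetric]) auto
      finally show ?case by (auto simp: indicator_def)
    qed
  qed
  also have "\<dots> = ennreal (c * d) * ((\<integral>\<^sup>+y\<in>cube a l. ennreal (\<phi> (h y / c)) \<partial>lebesgue) + (\<integral>\<^sup>+y\<in>cube a l. ennreal (\<psi> (g y / d)) \<partial>lebesgue))"
    by (subst nn_integral_cmult, measurable, subst nn_integral_add) auto
  also have "\<dots> \<le> ennreal (c * d) * (ennreal m + ennreal m)"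
    using bd by (intro mult_left_mono add_mono) auto
  also have "\<dots> = ennreal (2 * c * d) * ennreal m"
    using c d m by (subst ennreal_plus[symmetric], simp, simp, subst (1 2) ennreal_mult[symmetric]) (auto simp: algebra_simps)
  finally show ?thesis using l by (simp add: average_def emeasure_cube divide_le_ennreal_real m_def)
qed

text \<open>This provides the hypothesis \<open>key\<close> of the level estimates. If layer
  \<open>i\<close> misses \<open>x\<close>, the average of \<open>\<psi> (g / 2 powr i)\<close> over
  the cube is at most 1, and Hoelder with \<open>d = 2 powr i\<close> gives
  \<open>s \<le> 2 * c * 2 powr i\<close>; the layer sum lemma turns these bounds into one for
  \<open>s powr p\<close>. The layers are built from \<open>f\<close>, not from \<open>F\<close>, so
  the right side is the same for every truncation \<open>F\<close> of \<open>f\<close>.\<close>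

lemma two_weight_cube_estimate:
  fixes \<phi> \<psi> :: "real \<Rightarrow> real" and A :: "real ^ 'n ^ 'n" and w :: "real ^ 'n \<Rightarrow> real"
  assumes A: "invertible A" and p: "0 < p" and w: "w \<in> A_class A p \<phi>"
    and \<phi>: "continuous_on {0..} \<phi>" "\<And>s. 0 \<le> s \<Longrightarrow> 0 \<le> \<phi> s"
    and \<psi>: "continuous_on UNIV \<psi>" "\<And>s. 0 \<le> \<psi> s"
    and young: "\<And>s t. 0 \<le> s \<Longrightarrow> 0 \<le> t \<Longrightarrow> s * t \<le> \<phi> s + \<psi> t"
  obtains K where "0 \<le> K"
    "\<And>f F a l x s. f \<in> borel_measurable lebesgue \<Longrightarrow> (\<And>y. F y \<le> ennreal \<bar>f y\<bar>) \<Longrightarrow>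
      0 < l \<Longrightarrow> x \<in> cube a l \<Longrightarrow> 0 \<le> s \<Longrightarrow> ennreal s \<le> average (cube a l) F \<Longrightarrow>
      ennreal (s powr p) * (\<integral>\<^sup>+y\<in>cube a l. ennreal (w (A *v y)) \<partial>lebesgue)
        \<le> ennreal K * emeasure lebesgue (cube a l) * orlicz_layers p \<psi> (\<lambda>y. \<bar>f y\<bar> * w y powr (1 / p)) x"
proof -
  have wt: "weight w" using w by (simp add: A_class_def)
  note [measurable] = weight_borel_measurable[OF wt]
  have [measurable]: "\<psi> \<in> borel_measurable borel" using \<psi>(1) by (rule borel_measurable_continuous_onI)
  \<comment> \<open>\<open>\<phi>\<close> is controlled only on \<open>{0..}\<close>; clamping its
    argument gives a Borel function on the line that agrees with it at the arguments used.\<close>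
  have "continuous_on UNIV (\<lambda>s. \<phi> (max 0 s))"
    by (rule continuous_on_compose2[OF \<phi>(1)]) (auto intro!: continuous_intros)
  then have [measurable]: "(\<lambda>s. \<phi> (max 0 s)) \<in> borel_measurable borel" by (rule borel_measurable_continuous_onI)
  obtain K where K: "0 < K"
    "\<And>a l. 0 < l \<Longrightarrow> (\<integral>\<^sup>+y\<in>cube a l. ennreal (w (A *v y)) \<partial>lebesgue) \<noteq> 0 \<Longrightarrow>
      \<exists>c>0. average (cube a l) (\<lambda>y. ennreal (\<phi> (\<bar>w y powr (- 1 / p)\<bar> / c))) \<le> 1 \<and>
        ennreal (c powr p) * (\<integral>\<^sup>+y\<in>cube a l. ennreal (w (A *v y)) \<partial>lebesgue)
          \<le> ennreal (K powr p) * emeasure lebesgue (cube a l)"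
    using A_class_cube_bound[OF A p w] by blast
  show thesis
  proof (rule that[of "4 powr p * K powr p"])
    fix f :: "real ^ 'n \<Rightarrow> real" and F a l x s
    assume [measurable]: "f \<in> borel_measurable lebesgue" and F: "\<And>y. F y \<le> ennreal \<bar>f y\<bar>"
      and l: "0 < l" and x: "x \<in> cube a l" and s: "0 \<le> s" "ennreal s \<le> average (cube a l) F"
    define V where "V = (\<integral>\<^sup>+y\<in>cube a l. ennreal (w (A *v y)) \<partial>lebesgue)"
    define g where "g y = \<bar>f y\<bar> * w y powr (1 / p)" for y
    define N where "N = orlicz_layers p \<psi> g x"
    have [measurable]: "g \<in> borel_measurable lebesgue" unfolding g_def by measurable
    have "ennreal (s powr p) * V \<le> ennreal (4 powr p * K powr p) * emeasure lebesgue (cube a l) * N"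
    proof (cases "V = 0")
      case False
      then obtain c where c: "0 < c" "average (cube a l) (\<lambda>y. ennreal (\<phi> (\<bar>w y powr (- 1 / p)\<bar> / c))) \<le> 1"
        "ennreal (c powr p) * V \<le> ennreal (K powr p) * emeasure lebesgue (cube a l)"
        using K(2)[OF l, of a] unfolding V_def by blast
      have AE: "AE y in lebesgue. F y \<le> ennreal (g y * \<bar>w y powr (- 1 / p)\<bar>)"
      proof -
        have "AE y in lebesgue. 0 < w y" using wt by (simp add: weight_def)
        then show ?thesis
        proof eventually_elim
          case (elim y)
          then have "g y * \<bar>w y powr (- 1 / p)\<bar> = \<bar>f y\<bar> * (w y powr (1 / p) * w y powr (- 1 / p))"
            by (simp add: g_def)
          also have "w y powr (1 / p) * w y powr (- 1 / p) = 1" using elim by (simp flip: powr_add)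
          finally show ?case using F[of y] by simp
        qed
      qed
      define S where "S = {i::int. x \<in> level 1 (\<lambda>y. ennreal (\<psi> (g y / 2 powr i)))}"
      have bd: "s \<le> 2 * c * 2 powr i" if "i \<notin> S" for i :: int
      proof -
        have "average (cube a l) (\<lambda>y. ennreal (\<psi> (g y / 2 powr i))) \<le> 1"
          using that l x unfolding S_def mem_level mem_Collect_eq by (meson not_le)
        moreover have "(\<lambda>y. ennreal (\<phi> (max 0 (\<bar>w y powr (- 1 / p)\<bar> / c)))) \<in> borel_measurable lebesgue"
          by measurable
        then have "(\<lambda>y. ennreal (\<phi> (\<bar>w y powr (- 1 / p)\<bar> / c))) \<in> borel_measurable lebesgue"
          using c(1) by (simp add: max_absorb2)
        ultimately have "average (cube a l) F \<le> ennreal (2 * c * 2 powr i)"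
          using c l by (intro average_le_young[OF young \<phi>(2) \<psi>(2) _ _ _ _ _ _ _ _ _ AE]) (auto simp: g_def)
        with s(2) have "ennreal s \<le> ennreal (2 * c * 2 powr i)" by (rule order_trans)
        then show ?thesis using c by (subst (asm) ennreal_le_iff) auto
      qed
      \<comment> \<open>Layer sum lemma with base 2 and \<open>B = 2 * c\<close>: one 2 comes from
        Hoelder, the other from the ratio of consecutive layers, hence \<open>4 powr p\<close>. The
        power of \<open>c\<close> is then absorbed by the bump condition.\<close>
      have "ennreal (s powr p) \<le> ennreal ((2 * c * 2) powr p) *
          (\<integral>\<^sup>+i. ennreal (2 powr (real_of_int i * p)) * indicator S i \<partial>count_space UNIV)"
        using c s p bd by (intro ennreal_powr_le_layer_sum) auto
      also have "(\<integral>\<^sup>+i. ennreal (2 powr (real_of_int i * p)) * indicator S i \<partial>count_space UNIV) = N"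
        unfolding N_def orlicz_layers_def S_def by (intro nn_integral_cong) (auto simp: indicator_def)
      finally have "ennreal (s powr p) * V \<le> ennreal ((2 * c * 2) powr p) * N * V"
        by (rule mult_right_mono) simp
      also have "(2 * c * 2) powr p = 4 powr p * c powr p" using c by (simp add: powr_mult[symmetric])
      also have "ennreal (4 powr p * c powr p) * N * V = ennreal (4 powr p) * N * (ennreal (c powr p) * V)"
        by (simp add: ennreal_mult mult_ac)
      also have "\<dots> \<le> ennreal (4 powr p) * N * (ennreal (K powr p) * emeasure lebesgue (cube a l))"
        using c(3) by (rule mult_left_mono) simp
      also have "\<dots> = ennreal (4 powr p * K powr p) * emeasure lebesgue (cube a l) * N"
        by (simp add: ennreal_mult mult_ac)
      finally show ?thesis .
    qed simp
    then show "ennreal (s powr p) * (\<integral>\<^sup>+y\<in>cube a l. ennreal (w (A *v y)) \<partial>lebesgue)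
        \<le> ennreal (4 powr p * K powr p) * emeasure lebesgue (cube a l)
          * orlicz_layers p \<psi> (\<lambda>y. \<bar>f y\<bar> * w y powr (1 / p)) x"
      unfolding V_def N_def g_def .
  qed simp
qed

section \<open>Passage to general functions, substitution and assembly\<close>

text \<open>The choice of stopping cubes needs an integrable function, which a member of the
  weighted space need not be. Capping height and support gives integrable functions increasing to
  \<open>|f|\<close>; since \<open>R\<close> is common to all of them, monotone convergence, first
  for the level sets and then for the sum, preserves the bound.\<close>

lemma layer_sum_le_by_truncation:
  fixes f :: "real ^ 'n \<Rightarrow> real" and u :: "real ^ 'n \<Rightarrow> ennreal"
  assumes [measurable]: "f \<in> borel_measurable lebesgue" "u \<in> borel_measurable lebesgue"
    and bound: "\<And>F. F \<in> borel_measurable lebesgue \<Longrightarrow> (\<integral>\<^sup>+y. F y \<partial>lebesgue) < \<infinity> \<Longrightarrow>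
      (\<And>y. F y \<le> ennreal \<bar>f y\<bar>) \<Longrightarrow>
      (\<integral>\<^sup>+k. c k * (\<integral>\<^sup>+y\<in>level (t k) F. u y \<partial>lebesgue) \<partial>count_space I) \<le> R"
  shows "(\<integral>\<^sup>+k. c k * (\<integral>\<^sup>+y\<in>level (t k) (\<lambda>y. ennreal \<bar>f y\<bar>). u y \<partial>lebesgue) \<partial>count_space I) \<le> R"
proof -
  define F where "F j y = ennreal (min \<bar>f y\<bar> (real j)) * indicator (cball 0 (real j)) y" for j :: nat and y
  have [measurable]: "cball (0 :: real ^ 'n) r \<in> sets lebesgue" for r :: real by simp
  have [measurable]: "F j \<in> borel_measurable lebesgue" for j unfolding F_def by measurable
  have inc: "incseq F"
    by (rule incseq_SucI) (auto simp: F_def le_fun_def indicator_def intro!: ennreal_leI)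
  have Fle: "F j y \<le> ennreal \<bar>f y\<bar>" for j y by (auto simp: F_def indicator_def intro!: ennreal_leI)
  have SUP: "(SUP j. F j y) = ennreal \<bar>f y\<bar>" for y
  proof (rule antisym)
    show "(SUP j. F j y) \<le> ennreal \<bar>f y\<bar>" by (intro SUP_least Fle)
    obtain j :: nat where "max \<bar>f y\<bar> (norm y) \<le> real j" using real_arch_simple by blast
    then have "F j y = ennreal \<bar>f y\<bar>" by (simp add: F_def indicator_def min_absorb1)
    then show "ennreal \<bar>f y\<bar> \<le> (SUP j. F j y)" by (metis SUP_upper UNIV_I)
  qed
  have fin: "(\<integral>\<^sup>+y. F j y \<partial>lebesgue) < \<infinity>" for j
  proof -
    have "(\<integral>\<^sup>+y. F j y \<partial>lebesgue) \<le> (\<integral>\<^sup>+y. ennreal (real j) * indicator (cball (0 :: real ^ 'n) (real j)) y \<partial>lebesgue)"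
      by (intro nn_integral_mono) (auto simp: F_def indicator_def intro!: ennreal_leI)
    also have "\<dots> = ennreal (real j) * emeasure lebesgue (cball (0 :: real ^ 'n) (real j))"
      by (intro nn_integral_cmult_indicator) auto
    also have "\<dots> < \<infinity>"
      using emeasure_bounded_finite[of "cball 0 (real j) :: (real ^ 'n) set"]
      by (simp add: ennreal_mult_less_top emeasure_completion)
    finally show ?thesis .
  qed
  have lev: "incseq (\<lambda>j. level s (F j))" for s
    using inc unfolding incseq_def le_fun_def by (intro allI impI level_mono) auto
  have eq: "(\<integral>\<^sup>+y\<in>level s (\<lambda>y. ennreal \<bar>f y\<bar>). u y \<partial>lebesgue) = (SUP j. \<integral>\<^sup>+y\<in>level s (F j). u y \<partial>lebesgue)" for s
  proof -
    have "(\<integral>\<^sup>+y\<in>level s (\<lambda>y. ennreal \<bar>f y\<bar>). u y \<partial>lebesgue) = emeasure (density lebesgue u) (\<Union>j. level s (F j))"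
      unfolding SUP[symmetric] by (subst level_SUP[OF _ inc], measurable, subst emeasure_density) auto
    also have "\<dots> = (SUP j. emeasure (density lebesgue u) (level s (F j)))"
      using lev by (intro SUP_emeasure_incseq[symmetric]) auto
    also have "\<dots> = (SUP j. \<integral>\<^sup>+y\<in>level s (F j). u y \<partial>lebesgue)"
      by (intro SUP_cong) (auto simp: emeasure_density)
    finally show ?thesis .
  qed
  have "(\<integral>\<^sup>+k. c k * (\<integral>\<^sup>+y\<in>level (t k) (\<lambda>y. ennreal \<bar>f y\<bar>). u y \<partial>lebesgue) \<partial>count_space I)
    = (\<integral>\<^sup>+k. (SUP j. c k * (\<integral>\<^sup>+y\<in>level (t k) (F j). u y \<partial>lebesgue)) \<partial>count_space I)"
    unfolding eq by (simp add: SUP_mult_left_ennreal)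
  also have "\<dots> = (SUP j. \<integral>\<^sup>+k. c k * (\<integral>\<^sup>+y\<in>level (t k) (F j). u y \<partial>lebesgue) \<partial>count_space I)"
    using lev by (intro nn_integral_monotone_convergence_SUP)
      (auto simp: incseq_def le_fun_def intro!: mult_left_mono nn_integral_mono indicator_leI)
  also have "\<dots> \<le> R" by (intro SUP_least bound fin Fle) measurable
  finally show ?thesis .
qed

text \<open>Splitting into layers before substituting means that the substitution is applied to
  weighted indicators of open level sets, whose measurability is already known, rather than to a
  power of the maximal function.\<close>

lemma nn_integral_maximal_inv_le:
  fixes A :: "real ^ 'n ^ 'n" and w :: "real ^ 'n \<Rightarrow> real"
  assumes A: "invertible A" and b: "1 < b" and p: "0 < p" and w [measurable]: "w \<in> borel_measurable lebesgue"
  obtains C where "0 < C" "\<And>f. (\<integral>\<^sup>+x. epowr (maximal_inv A f x) p * ennreal (w x) \<partial>lebesgue)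
    \<le> ennreal C * (\<integral>\<^sup>+k. ennreal (b powr (real_of_int k * p)) *
      (\<integral>\<^sup>+y\<in>level (ennreal (b powr k)) (\<lambda>y. ennreal \<bar>f y\<bar>). ennreal (w (A *v y)) \<partial>lebesgue) \<partial>count_space UNIV)"
proof -
  note [measurable] = measurable_matrix_vector_mult_lebesgue[OF A]
    measurable_matrix_vector_mult_lebesgue[OF invertible_matrix_inv[OF A]]
  obtain C :: real where C: "0 < C" "\<And>h. h \<in> borel_measurable lebesgue \<Longrightarrow>
      (\<integral>\<^sup>+x. h (matrix_inv A *v x) \<partial>lebesgue) \<le> ennreal C * (\<integral>\<^sup>+x. h x \<partial>lebesgue)"
    using nn_integral_linear_le(2)[OF invertible_matrix_inv[OF A]] by blast
  show thesis
  proof (rule that[of "b powr p * C"])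
    show "0 < b powr p * C" using b C by simp
    fix f :: "real ^ 'n \<Rightarrow> real"
    define L where "L k = level (ennreal (b powr real_of_int k)) (\<lambda>y. ennreal \<bar>f y\<bar>)" for k
    have [measurable]: "L k \<in> sets lebesgue" for k by (simp add: L_def)
    \<comment> \<open>At \<open>y = matrix_inv A *v x\<close> the factor \<open>w (A *v y)\<close>
      is \<open>w x\<close>, so \<open>h k\<close> composed with the inverse is the k-th layer of
      the original integrand.\<close>
    define h where "h k y = ennreal (b powr (real_of_int k * p)) * (ennreal (w (A *v y)) * indicator (L k) y)" for k y
    have [measurable]: "h k \<in> borel_measurable lebesgue" for k unfolding h_def by measurable
    have "(\<integral>\<^sup>+x. epowr (maximal_inv A f x) p * ennreal (w x) \<partial>lebesgue)
      \<le> (\<integral>\<^sup>+x. ennreal (b powr p) * (\<integral>\<^sup>+k. h k (matrix_inv A *v x) \<partial>count_space UNIV) \<partial>lebesgue)"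
    proof (intro nn_integral_mono)
      fix x
      have "epowr (maximal_inv A f x) p * ennreal (w x) \<le> ennreal (b powr p) *
        (\<integral>\<^sup>+k. ennreal (b powr (real_of_int k * p)) * indicator {k::int. ennreal (b powr k) < maximal_inv A f x} k \<partial>count_space UNIV)
        * ennreal (w x)"
        by (intro mult_right_mono epowr_le_layer_sum b p) simp
      also have "\<dots> = ennreal (b powr p) * ((\<integral>\<^sup>+k. ennreal (b powr (real_of_int k * p)) *
          indicator {k::int. ennreal (b powr k) < maximal_inv A f x} k * ennreal (w x) \<partial>count_space UNIV))"
        by (subst nn_integral_multc) (auto simp: mult.assoc)
      also have "(\<integral>\<^sup>+k. ennreal (b powr (real_of_int k * p)) *
          indicator {k::int. ennreal (b powr k) < maximal_inv A f x} k * ennreal (w x) \<partial>count_space UNIV)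
        = (\<integral>\<^sup>+k. h k (matrix_inv A *v x) \<partial>count_space UNIV)"
        using invertible_matrix_vector_inv(2)[OF A]
        by (intro nn_integral_cong) (simp add: h_def L_def maximal_inv_def less_maximal_iff indicator_def)
      finally show "epowr (maximal_inv A f x) p * ennreal (w x)
        \<le> ennreal (b powr p) * (\<integral>\<^sup>+k. h k (matrix_inv A *v x) \<partial>count_space UNIV)" .
    qed
    also have "\<dots> = ennreal (b powr p) * (\<integral>\<^sup>+x. \<integral>\<^sup>+k. h k (matrix_inv A *v x) \<partial>count_space UNIV \<partial>lebesgue)"
      by (intro nn_integral_cmult borel_measurable_count_space_nn_integral) measurable
    also have "\<dots> = ennreal (b powr p) * (\<integral>\<^sup>+k. \<integral>\<^sup>+x. h k (matrix_inv A *v x) \<partial>lebesgue \<partial>count_space UNIV)"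
      by (subst nn_integral_count_space_nn_integral) auto
    also have "\<dots> \<le> ennreal (b powr p) * (\<integral>\<^sup>+k. ennreal C * (\<integral>\<^sup>+y. h k y \<partial>lebesgue) \<partial>count_space UNIV)"
      by (intro mult_left_mono nn_integral_mono C(2)) auto
    also have "\<dots> = ennreal (b powr p * C) * (\<integral>\<^sup>+k. (\<integral>\<^sup>+y. h k y \<partial>lebesgue) \<partial>count_space UNIV)"
      using C(1) by (simp add: nn_integral_cmult ennreal_mult mult.assoc)
    also have "(\<lambda>k. \<integral>\<^sup>+y. h k y \<partial>lebesgue) = (\<lambda>k. ennreal (b powr (real_of_int k * p)) * (\<integral>\<^sup>+y\<in>L k. ennreal (w (A *v y)) \<partial>lebesgue))"
      unfolding h_def by (intro ext nn_integral_cmult) measurable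
    finally show "(\<integral>\<^sup>+x. epowr (maximal_inv A f x) p * ennreal (w x) \<partial>lebesgue)
      \<le> ennreal (b powr p * C) * (\<integral>\<^sup>+k. ennreal (b powr (real_of_int k * p)) *
      (\<integral>\<^sup>+y\<in>level (ennreal (b powr k)) (\<lambda>y. ennreal \<bar>f y\<bar>). ennreal (w (A *v y)) \<partial>lebesgue) \<partial>count_space UNIV)"
      unfolding L_def .
  qed
qed

theorem theorem1p1:
  fixes A :: "real ^ 'n ^ 'n" and p :: real and \<phi> :: "real \<Rightarrow> real" and w :: "real ^ 'n \<Rightarrow> real"
  assumes "invertible A"
    and "1 < p"
    and "young_function \<phi>"
    and "complementary \<phi> \<in> B_class p"
    and "w \<in> A_class A p \<phi>"
  shows "\<exists>C::real. \<forall>f\<in>Lp_weighted p w.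
    (\<integral>\<^sup>+x. epowr (maximal_inv A f x) p * ennreal (w x) \<partial>lebesgue)
      \<le> ennreal C * (\<integral>\<^sup>+x. ennreal (\<bar>f x\<bar> powr p) * ennreal (w x) \<partial>lebesgue)"
proof -
  note A = assms(1) and w = assms(5)
  have p: "0 < p" using assms(2) by simp
  have wt: "weight w" using w by (simp add: A_class_def)
  note [measurable] = weight_borel_measurable[OF wt] measurable_matrix_vector_mult_lebesgue[OF A]
  \<comment> \<open>Extending by the value at 0 makes \<open>\<psi>\<close> continuous on the whole
    line, hence Borel. Passing to real values loses nothing on \<open>{0..}\<close>, since
    membership in \<open>B_class p\<close> includes finiteness.\<close>
  define \<psi> where "\<psi> t = enn2real (complementary \<phi> (max 0 t))" for t
  have fin: "\<And>t. 0 \<le> t \<Longrightarrow> complementary \<phi> t < \<infinity>"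
    and yf: "young_function (\<lambda>t. enn2real (complementary \<phi> t))"
    and Bp: "(\<integral>\<^sup>+t\<in>{1..}. complementary \<phi> t / ennreal (t powr p) / ennreal t \<partial>lborel) < \<infinity>"
    using assms(4) by (auto simp: B_class_def)
  have cont: "continuous_on UNIV \<psi>"
    unfolding \<psi>_def using yf unfolding young_function_def
    by (intro continuous_on_compose2[of "{0..}" "\<lambda>t. enn2real (complementary \<phi> t)" UNIV "max 0"])
      (auto intro!: continuous_intros)
  have mono: "mono_on {0..} \<psi>"
    using yf by (auto simp: young_function_def \<psi>_def monotone_on_def)
  have conv: "convex_on {0..} \<psi>"
  proof -
    have "convex_on {0..} (\<lambda>t. enn2real (complementary \<phi> t))" using yf by (simp add: young_function_def)
    then show ?thesis unfolding convex_on_def \<psi>_def by (auto simp: max_absorb2)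
  qed
  have \<psi>0: "\<psi> 0 = 0" using yf by (simp add: young_function_def \<psi>_def)
  have \<psi>nn: "0 \<le> \<psi> t" for t by (simp add: \<psi>_def)
  have young: "s * t \<le> \<phi> s + \<psi> t" if "0 \<le> s" "0 \<le> t" for s t
    using young_inequality[of \<phi> t s] fin that by (simp add: \<psi>_def)
  have "(\<integral>\<^sup>+t\<in>{1..}. ennreal (\<psi> t / t powr (p + 1)) \<partial>lborel)
      = (\<integral>\<^sup>+t\<in>{1..}. complementary \<phi> t / ennreal (t powr p) / ennreal t \<partial>lborel)"
  proof (intro nn_integral_cong)
    fix t :: real
    show "ennreal (\<psi> t / t powr (p + 1)) * indicator {1..} t
      = complementary \<phi> t / ennreal (t powr p) / ennreal t * indicator {1..} t"
    proof (cases "1 \<le> t")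
      case True
      then have "complementary \<phi> t = ennreal (\<psi> t)" using fin[of t] by (simp add: \<psi>_def)
      then show ?thesis using True \<psi>nn[of t] by (simp add: divide_ennreal powr_add)
    qed simp
  qed
  with Bp have Bp': "(\<integral>\<^sup>+t\<in>{1..}. ennreal (\<psi> t / t powr (p + 1)) \<partial>lborel) < \<infinity>" by simp
  obtain C2 where C2: "0 < C2" "\<And>g::real ^ 'n \<Rightarrow> real. g \<in> borel_measurable lebesgue \<Longrightarrow> (\<And>x. 0 \<le> g x) \<Longrightarrow>
      (\<integral>\<^sup>+x. orlicz_layers p \<psi> g x \<partial>lebesgue) \<le> ennreal C2 * (\<integral>\<^sup>+x. ennreal (g x powr p) \<partial>lebesgue)"
    using nn_integral_orlicz_layers_le[OF cont mono \<psi>nn conv \<psi>0 p Bp'] by blast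
  have \<phi>: "continuous_on {0..} \<phi>" "\<And>s. 0 \<le> s \<Longrightarrow> 0 \<le> \<phi> s" using assms(3) by (auto simp: young_function_def)
  obtain K where K: "0 \<le> K"
    "\<And>f F a l x s. f \<in> borel_measurable lebesgue \<Longrightarrow> (\<And>y. F y \<le> ennreal \<bar>f y\<bar>) \<Longrightarrow>
      0 < l \<Longrightarrow> x \<in> cube a l \<Longrightarrow> 0 \<le> s \<Longrightarrow> ennreal s \<le> average (cube a l) F \<Longrightarrow>
      ennreal (s powr p) * (\<integral>\<^sup>+y\<in>cube a l. ennreal (w (A *v y)) \<partial>lebesgue)
        \<le> ennreal K * emeasure lebesgue (cube a l) * orlicz_layers p \<psi> (\<lambda>y. \<bar>f y\<bar> * w y powr (1 / p)) x"
    using two_weight_cube_estimate[OF A p w \<phi> cont \<psi>nn young] by blast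
  define D where "D = (10 * real CARD('n)) ^ CARD('n)"
  define b where "b = 2 * D\<^sup>2"
  have "1 \<le> real CARD('n)" by (simp add: Suc_leI)
  then have "1 \<le> 10 * real CARD('n)" by linarith
  then have D: "1 \<le> D" unfolding D_def by (rule one_le_power)
  then have b: "1 < b" unfolding b_def using one_le_power[of D 2] by linarith
  obtain C3 where C3: "0 < C3" "\<And>f. (\<integral>\<^sup>+x. epowr (maximal_inv A f x) p * ennreal (w x) \<partial>lebesgue)
    \<le> ennreal C3 * (\<integral>\<^sup>+k. ennreal (b powr (real_of_int k * p)) *
      (\<integral>\<^sup>+y\<in>level (ennreal (b powr k)) (\<lambda>y. ennreal \<bar>f y\<bar>). ennreal (w (A *v y)) \<partial>lebesgue) \<partial>count_space UNIV)"
    using nn_integral_maximal_inv_le[OF A b p weight_borel_measurable[OF wt]] by blast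
  define C1 where "C1 = 2 * D powr p * D * K"
  show ?thesis
  proof (intro exI[of _ "C3 * (C1 * C2)"] ballI)
    fix f assume "f \<in> Lp_weighted p w"
    then have [measurable]: "f \<in> borel_measurable lebesgue" by (simp add: Lp_weighted_def)
    define g where "g y = \<bar>f y\<bar> * w y powr (1 / p)" for y
    have [measurable]: "g \<in> borel_measurable lebesgue" unfolding g_def by measurable
    have "(\<integral>\<^sup>+k. ennreal (b powr (real_of_int k * p)) *
      (\<integral>\<^sup>+y\<in>level (ennreal (b powr k)) (\<lambda>y. ennreal \<bar>f y\<bar>). ennreal (w (A *v y)) \<partial>lebesgue) \<partial>count_space UNIV)
      \<le> ennreal C1 * (\<integral>\<^sup>+x. orlicz_layers p \<psi> g x \<partial>lebesgue)"
      unfolding C1_def b_def D_def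
    \<comment> \<open>The right side involves the layers of \<open>g\<close>, which is built from
      \<open>f\<close> itself, so it is a common bound for all truncations \<open>F\<close>.\<close>
    proof (intro layer_sum_le_by_truncation level_sum_estimate)
      fix F a l x s
      assume "\<And>y. F y \<le> ennreal \<bar>f y\<bar>" "0 < l" "x \<in> cube a l" "0 \<le> s" "ennreal s \<le> average (cube a l) F"
      then show "ennreal (s powr p) * (\<integral>\<^sup>+y\<in>cube a l. ennreal (w (A *v y)) \<partial>lebesgue)
        \<le> ennreal K * emeasure lebesgue (cube a l) * orlicz_layers p \<psi> g x"
        unfolding g_def by (intro K(2)) auto
    qed (use K(1) p in auto)
    also have "\<dots> \<le> ennreal C1 * (ennreal C2 * (\<integral>\<^sup>+x. ennreal (g x powr p) \<partial>lebesgue))"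
      by (intro mult_left_mono C2(2)) (auto simp: g_def)
    also have "(\<integral>\<^sup>+x. ennreal (g x powr p) \<partial>lebesgue) = (\<integral>\<^sup>+x. ennreal (\<bar>f x\<bar> powr p) * ennreal (w x) \<partial>lebesgue)"
    proof (intro nn_integral_cong_AE)
      \<comment> \<open>Positivity of \<open>w x\<close> is used for
        \<open>(w x powr (1 / p)) powr p = w x\<close>, so the two integrands are compared almost
        everywhere.\<close>
      have "AE x in lebesgue. 0 < w x" using wt by (simp add: weight_def)
      then show "AE x in lebesgue. ennreal (g x powr p) = ennreal (\<bar>f x\<bar> powr p) * ennreal (w x)"
        by eventually_elim (use p in \<open>simp add: g_def powr_mult powr_powr ennreal_mult\<close>)
    qed
    finally have "ennreal C3 * (\<integral>\<^sup>+k. ennreal (b powr (real_of_int k * p)) *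
      (\<integral>\<^sup>+y\<in>level (ennreal (b powr k)) (\<lambda>y. ennreal \<bar>f y\<bar>). ennreal (w (A *v y)) \<partial>lebesgue) \<partial>count_space UNIV)
      \<le> ennreal C3 * (ennreal C1 * (ennreal C2 * (\<integral>\<^sup>+x. ennreal (\<bar>f x\<bar> powr p) * ennreal (w x) \<partial>lebesgue)))"
      by (rule mult_left_mono) simp
    also have "\<dots> = ennreal (C3 * (C1 * C2)) * (\<integral>\<^sup>+x. ennreal (\<bar>f x\<bar> powr p) * ennreal (w x) \<partial>lebesgue)"
      using C2(1) C3(1) K(1) D by (simp add: C1_def ennreal_mult mult.assoc)
    finally show "(\<integral>\<^sup>+x. epowr (maximal_inv A f x) p * ennreal (w x) \<partial>lebesgue)
      \<le> ennreal (C3 * (C1 * C2)) * (\<integral>\<^sup>+x. ennreal (\<bar>f x\<bar> powr p) * ennreal (w x) \<partial>lebesgue)"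
      by (rule order_trans[OF C3(2)])
  qed
qed

end
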